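(* Let $k\ge 3$ be an integer. Then the vertex operator algebra $\mathcal W$ is generated by $W^3$, and its automorphism group $\mathrm{Aut}\,\mathcal W=\langle\theta\rangle$ is of order $2$.
   Context: Let $\{h,e,f\}$ be the standard Chevalley basis of $sl_2$, with normalized form $\langle h,h\rangle=2$, $\langle e,f\rangle=1$. $V(k,0)$ is the universal affine vertex operator algebra (Weyl module) of $\widehat{sl}_2=sl_2\otimes\mathbb C[t,t^{-1}]\oplus\mathbb C C$ at level $k$, generated by the vacuum $\mathbf 1$ with $(sl_2\otimes\mathbb C[t])\mathbf 1=0$ and $C=k$; $a(n)$ denotes the action of $a\otimes t^n$. $L(k,0)=V(k,0)/\mathcal J$ is its simple quotient, where $\mathcal J$ is the unique maximal ideal. For $v$ in a vertex operator algebra, $v_n$ is the coefficient of $x^{-n-1}$ in $Y(v,x)$. Let $N_0=\{v\in V(k,0) : h(m)v=0 \text{ for all } m\ge 0\}$, the commutant in $V(k,0)$ of the Heisenberg subalgebra generated by $h(-1)\mathbf 1$. It is a vertex operator algebra with conformal vector $$\omega=\tfrac{1}{2k(k+2)}\big(-k\,h(-2)\mathbf 1-h(-1)^2\mathbf 1+2k\,e(-1)f(-1)\mathbf 1\big)$$ of central charge $2(k-1)/(k+2)$. For $i=3,4,5$, $W^i$ denotes a nonzero vector of weight $i$ in $N_0$ with $\omega_1W^i=iW^i$, $\omega_2W^i=\omega_3W^i=0$; it is unique up to a scalar multiple, and $$W^3=k^2h(-3)\mathbf 1+3kh(-2)h(-1)\mathbf 1+2h(-1)^3\mathbf 1-6kh(-1)e(-1)f(-1)\mathbf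 1+3k^2e(-2)f(-1)\mathbf 1-3k^2e(-1)f(-2)\mathbf 1.$$ The images of these vectors in $L(k,0)$ are denoted by the same symbols. $K_0=\{v\in L(k,0): h(m)v=0 \text{ for all } m\ge0\}$ is a vertex operator algebra with conformal vector $\omega$, and $\mathcal W$ is the vertex operator subalgebra of $K_0$ generated by $\omega,W^3,W^4,W^5$. The automorphism $h\mapsto -h$, $e\mapsto f$, $f\mapsto e$ of $sl_2$ lifts to an automorphism of $V(k,0)$ of order $2$, which induces an automorphism of $L(k,0)$ preserving $\mathcal W$ (it fixes $\omega$ and sends $W^3$ to $-W^3$); $\theta$ denotes its restriction to $\mathcal W$. *)

theory Defs
  imports
    Complex_Main
    "HOL-Library.Poly_Mapping"
    "HOL-Algebra.Bij"
    "HOL-Algebra.Generated_Groups"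
begin

section \<open>Vertex algebras\<close>

text \<open>The product \<open>nprod V u n v\<close> is \<open>u_n v\<close>, the coefficient of \<open>x^(-n-1)\<close> in \<open>Y(u,x)v\<close>.\<close>

record 'v vertex_structure =
  scal :: "complex \<Rightarrow> 'v \<Rightarrow> 'v"
  vacuum :: 'v
  nprod :: "'v \<Rightarrow> int \<Rightarrow> 'v \<Rightarrow> 'v"

text \<open>
  The Jacobi identity is stated in its component form (Borcherds identity).  By truncation both
  sums have finite support, so that \<^const>\<open>Sum_any\<close> is the intended sum.
\<close>

locale vertex_algebra = vector_space "scal V"
  for V :: "'v::ab_group_add vertex_structure" +
  assumes linear_right: "Vector_Spaces.linear (scal V) (scal V) (\<lambda>v. nprod V u n v)"
    and linear_left: "Vector_Spaces.linear (scal V) (scal V) (\<lambda>u. nprod V u n v)"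
    and truncation: "\<exists>N. \<forall>n\<ge>N. nprod V u n v = 0"
    and vacuum_left: "nprod V (vacuum V) n v = (if n = -1 then v else 0)"
    and creation: "nprod V v (-1) (vacuum V) = v"
    and creation_nonneg: "n \<ge> 0 \<Longrightarrow> nprod V v n (vacuum V) = 0"
    and borcherds:
      "Sum_any (\<lambda>i::nat. scal V (of_int p gchoose i)
          (nprod V (nprod V u (r + int i) v) (p + q - int i) w)) =
       Sum_any (\<lambda>i::nat. scal V ((-1) ^ i * (of_int r gchoose i))
          (nprod V u (p + r - int i) (nprod V v (q + int i) w) -
           scal V ((-1) powi r) (nprod V v (q + r - int i) (nprod V u (p + int i) w))))"

definition vertex_hom ::
    "'v::ab_group_add vertex_structure \<Rightarrow> 'l::ab_group_add vertex_structure \<Rightarrow> ('v \<Rightarrow> 'l) \<Rightarrow> bool" where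
  "vertex_hom V L f \<longleftrightarrow>
     Vector_Spaces.linear (scal V) (scal L) f \<and> f (vacuum V) = vacuum L \<and>
     (\<forall>u n v. f (nprod V u n v) = nprod L (f u) n (f v))"

definition vertex_subalgebra :: "'v::ab_group_add vertex_structure \<Rightarrow> 'v set \<Rightarrow> bool" where
  "vertex_subalgebra V U \<longleftrightarrow>
     module.subspace (scal V) U \<and> vacuum V \<in> U \<and>
     (\<forall>u\<in>U. \<forall>v\<in>U. \<forall>n. nprod V u n v \<in> U)"

text \<open>
  The subalgebra of the subalgebra \<open>A\<close> generated by \<open>S\<close>.  No conformal vector is adjoined: if it
  is to lie in the generated subalgebra, it has to be obtained from \<open>S\<close>.
\<close>

definition generated_subalgebra ::
    "'v::ab_group_add vertex_structure \<Rightarrow> 'v set \<Rightarrow> 'v set \<Rightarrow> 'v set" where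
  "generated_subalgebra V A S = (\<lambda>U. vertex_subalgebra V U \<and> U \<subseteq> A) hull S"

definition vertex_ideal :: "'v::ab_group_add vertex_structure \<Rightarrow> 'v set \<Rightarrow> bool" where
  "vertex_ideal V I \<longleftrightarrow>
     module.subspace (scal V) I \<and>
     (\<forall>u. \<forall>v\<in>I. \<forall>n. nprod V u n v \<in> I \<and> nprod V v n u \<in> I)"

definition maximal_vertex_ideal :: "'v::ab_group_add vertex_structure \<Rightarrow> 'v set \<Rightarrow> bool" where
  "maximal_vertex_ideal V I \<longleftrightarrow>
     vertex_ideal V I \<and> I \<noteq> UNIV \<and>
     (\<forall>I'. vertex_ideal V I' \<and> I \<subseteq> I' \<longrightarrow> I' = I \<or> I' = UNIV)"

text \<open>\<open>L\<close> is, via the projection \<open>\<pi>\<close>, the quotient of \<open>V\<close> by a maximal ideal.\<close>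

definition simple_quotient ::
    "'v::ab_group_add vertex_structure \<Rightarrow> 'l::ab_group_add vertex_structure \<Rightarrow> ('v \<Rightarrow> 'l) \<Rightarrow> bool" where
  "simple_quotient V L \<pi> \<longleftrightarrow>
     vertex_algebra L \<and> vertex_hom V L \<pi> \<and> surj \<pi> \<and> maximal_vertex_ideal V {v. \<pi> v = 0}"

text \<open>
  Automorphisms of the vertex operator algebra with underlying space \<open>U\<close> (a subalgebra of \<open>V\<close>) and
  conformal vector \<open>\<omega>\<close>; as in \<^const>\<open>Bij\<close> they are extensional functions.
\<close>

definition voa_automorphisms ::
    "'v::ab_group_add vertex_structure \<Rightarrow> 'v set \<Rightarrow> 'v \<Rightarrow> ('v \<Rightarrow> 'v) set" where
  "voa_automorphisms V U \<omega> =
     {g \<in> Bij U.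
        (\<forall>u\<in>U. \<forall>v\<in>U. g (u + v) = g u + g v) \<and>
        (\<forall>c. \<forall>v\<in>U. g (scal V c v) = scal V c (g v)) \<and>
        (\<forall>u\<in>U. \<forall>v\<in>U. \<forall>n. g (nprod V u n v) = nprod V (g u) n (g v)) \<and>
        g (vacuum V) = vacuum V \<and> g \<omega> = \<omega>}"

definition voa_Aut ::
    "'v::ab_group_add vertex_structure \<Rightarrow> 'v set \<Rightarrow> 'v \<Rightarrow> ('v \<Rightarrow> 'v) monoid" where
  "voa_Aut V U \<omega> = BijGroup U \<lparr>carrier := voa_automorphisms V U \<omega>\<rparr>"

section \<open>The universal affine vertex algebra of \<open>sl_2\<close>\<close>

text \<open>The Chevalley basis \<open>h, e, f\<close>.\<close>

datatype sl2_basis = ch | ce | cf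

text \<open>\<open>sl2_bracket x y z\<close> is the coefficient of \<open>z\<close> in \<open>[x,y]\<close>.\<close>

fun sl2_bracket :: "sl2_basis \<Rightarrow> sl2_basis \<Rightarrow> sl2_basis \<Rightarrow> complex" where
  "sl2_bracket ch ce ce = 2"
| "sl2_bracket ce ch ce = -2"
| "sl2_bracket ch cf cf = -2"
| "sl2_bracket cf ch cf = 2"
| "sl2_bracket ce cf ch = 1"
| "sl2_bracket cf ce ch = -1"
| "sl2_bracket _ _ _ = 0"

fun sl2_form :: "sl2_basis \<Rightarrow> sl2_basis \<Rightarrow> complex" where
  "sl2_form ch ch = 2"
| "sl2_form ce cf = 1"
| "sl2_form cf ce = 1"
| "sl2_form _ _ = 0"

text \<open>
  The letter \<open>(x, n)\<close> stands for \<open>x(n) = x \<otimes> t^n\<close>; elements of the free associative algebra on these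
  letters are finitely supported functions on words.  The set below spans the kernel of the
  projection of the free algebra onto the module induced from the one-dimensional module \<open>\<complex>\<one>\<close> of
  \<open>sl_2[t] + \<complex> C\<close>, on which \<open>sl_2[t]\<close> is zero and \<open>C\<close> is \<open>k\<close>: the two-sided ideal of the
  commutation relations, with \<open>C\<close> replaced by \<open>k\<close>, plus the left ideal generated by the \<open>x(n)\<close>
  with \<open>n \<ge> 0\<close>.
\<close>

type_synonym affine_word = "(sl2_basis \<times> int) list"

definition affine_relations :: "complex \<Rightarrow> (affine_word \<Rightarrow>\<^sub>0 complex) set" where
  "affine_relations k =
     {Poly_Mapping.single (u @ [(x, m), (y, n)] @ w) 1
        - Poly_Mapping.single (u @ [(y, n), (x, m)] @ w) 1
        - (\<Sum>z\<in>{ch, ce, cf}. Poly_Mapping.single (u @ [(z, m + n)] @ w) (sl2_bracket x y z))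
        - Poly_Mapping.single (u @ w) (if m + n = 0 then of_int m * sl2_form x y * k else 0)
      | u x m y n w. True} \<union>
     {Poly_Mapping.single (u @ [(x, n)]) 1 | u x n. n \<ge> 0}"

primrec word_vector ::
    "'v::ab_group_add vertex_structure \<Rightarrow> (sl2_basis \<Rightarrow> 'v) \<Rightarrow> affine_word \<Rightarrow> 'v" where
  "word_vector V a [] = vacuum V"
| "word_vector V a (l # w) = nprod V (a (fst l)) (snd l) (word_vector V a w)"

definition word_eval ::
    "'v::ab_group_add vertex_structure \<Rightarrow> (sl2_basis \<Rightarrow> 'v) \<Rightarrow> (affine_word \<Rightarrow>\<^sub>0 complex) \<Rightarrow> 'v" where
  "word_eval V a p =
     (\<Sum>w\<in>Poly_Mapping.keys p. scal V (Poly_Mapping.lookup p w) (word_vector V a w))"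

text \<open>
  \<open>V\<close> is the vertex algebra \<open>V(k,0)\<close>, where \<open>a x\<close> is the vector \<open>x(-1)\<one>\<close>: the modes of the \<open>a x\<close>
  make \<open>V\<close> a module of level \<open>k\<close> for the affine Lie algebra, and this module is the one
  induced from \<open>\<complex>\<one>\<close>.
\<close>

locale universal_affine_sl2 = vertex_algebra V
  for V :: "'v::ab_group_add vertex_structure" +
  fixes k :: complex and a :: "sl2_basis \<Rightarrow> 'v"
  assumes affine_commutator:
      "nprod V (a x) m (nprod V (a y) n v) - nprod V (a y) n (nprod V (a x) m v) =
         (\<Sum>z\<in>{ch, ce, cf}. scal V (sl2_bracket x y z) (nprod V (a z) (m + n) v))
         + scal V (if m + n = 0 then of_int m * sl2_form x y * k else 0) v"
    and word_eval_surj: "surj (word_eval V a)"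
    and word_eval_kernel:
      "{p. word_eval V a p = 0} =
         module.span (\<lambda>c. Poly_Mapping.map ((*) c)) (affine_relations k)"

section \<open>Parafermion vectors\<close>

text \<open>
  The following take the images of \<open>h(-1)\<one>, e(-1)\<one>, f(-1)\<one>\<close> as the argument \<open>a\<close>, so that they
  apply to \<open>V(k,0)\<close> as well as to its quotient \<open>L(k,0)\<close>.
\<close>

definition heisenberg_commutant ::
    "'v::ab_group_add vertex_structure \<Rightarrow> (sl2_basis \<Rightarrow> 'v) \<Rightarrow> 'v set" where
  "heisenberg_commutant V a = {v. \<forall>m\<ge>0. nprod V (a ch) m v = 0}"

definition parafermion_omega ::
    "'v::ab_group_add vertex_structure \<Rightarrow> complex \<Rightarrow> (sl2_basis \<Rightarrow> 'v) \<Rightarrow> 'v" where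
  "parafermion_omega V k a =
     (let h = nprod V (a ch); e = nprod V (a ce); f = nprod V (a cf); vac = vacuum V
      in scal V (1 / (2 * k * (k + 2)))
           (scal V (- k) (h (-2) vac) - h (-1) (h (-1) vac) + scal V (2 * k) (e (-1) (f (-1) vac))))"

definition parafermion_W3 ::
    "'v::ab_group_add vertex_structure \<Rightarrow> complex \<Rightarrow> (sl2_basis \<Rightarrow> 'v) \<Rightarrow> 'v" where
  "parafermion_W3 V k a =
     (let h = nprod V (a ch); e = nprod V (a ce); f = nprod V (a cf); vac = vacuum V
      in scal V (k ^ 2) (h (-3) vac)
         + scal V (3 * k) (h (-2) (h (-1) vac))
         + scal V 2 (h (-1) (h (-1) (h (-1) vac)))
         - scal V (6 * k) (h (-1) (e (-1) (f (-1) vac)))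
         + scal V (3 * k ^ 2) (e (-2) (f (-1) vac))
         - scal V (3 * k ^ 2) (e (-1) (f (-2) vac)))"

text \<open>
  The nonzero vectors of weight \<open>i\<close> in the commutant that are singular for the Virasoro algebra
  of the modes of \<open>\<omega>\<close>.
\<close>

definition parafermion_primary ::
    "'v::ab_group_add vertex_structure \<Rightarrow> complex \<Rightarrow> (sl2_basis \<Rightarrow> 'v) \<Rightarrow> nat \<Rightarrow> 'v \<Rightarrow> bool" where
  "parafermion_primary V k a i w \<longleftrightarrow>
     (let \<omega> = parafermion_omega V k a
      in w \<noteq> 0 \<and> w \<in> heisenberg_commutant V a \<and>
         nprod V \<omega> 1 w = scal V (of_nat i) w \<and> nprod V \<omega> 2 w = 0 \<and> nprod V \<omega> 3 w = 0)"

text \<open>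
  The automorphism of \<open>V(k,0)\<close> that lifts the automorphism \<open>h \<mapsto> -h\<close>, \<open>e \<mapsto> f\<close>, \<open>f \<mapsto> e\<close> of \<open>sl_2\<close>.
\<close>

definition lifted_involution ::
    "'v::ab_group_add vertex_structure \<Rightarrow> (sl2_basis \<Rightarrow> 'v) \<Rightarrow> ('v \<Rightarrow> 'v) \<Rightarrow> bool" where
  "lifted_involution V a g \<longleftrightarrow>
     vertex_hom V V g \<and> bij g \<and> g (a ch) = - a ch \<and> g (a ce) = a cf \<and> g (a cf) = a ce"

end

theory Submission
  imports
    Defs
    "HOL-Library.Multiset"
begin

text \<open>
  Let \<open>N\<close> be the commutant of the Heisenberg algebra in \<open>L(k,0)\<close> and \<open>H\<close> the sum of the images
  of the creation modes \<open>h(-n)\<close>.  Then \<open>N \<inter> H = 0\<close>, so vectors of \<open>N\<close> may be compared modulo \<open>H\<close>,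
  where \<open>L(k,0)\<close> is spanned by words in the creation modes of \<open>e\<close> and \<open>f\<close>.  Modulo \<open>H\<close>, the modes of
  \<open>\<omega>\<close> and \<open>W3\<close> act on \<open>N\<close> through the modes of \<open>e(-1)f(-1)\<one>\<close> and \<open>e(-2)f(-1)\<one>\<close> alone,
  and charge zero is spanned by 1, 2, 4, 6 words in weights 2, 3, 4, 5.  All these words are
  reached from \<open>W3\<close> by its products and by derivatives; hence a subalgebra of \<open>N\<close> that contains
  \<open>W3\<close> contains every vector of \<open>N\<close> of these weights, in particular \<open>\<omega>\<close>, \<open>W4\<close> and \<open>W5\<close>.
  An automorphism fixes \<open>\<omega>\<close> and therefore maps \<open>W3\<close>, up to scalars the only primary vector of
  weight 3, to some \<open>c W3\<close>; as \<open>W3_3 W3\<close> is a nonzero multiple of \<open>\<omega>\<close>, \<open>c^2 = 1\<close>.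

  Identities between vectors are proved by applying an arbitrary linear functional, which turns
  them into polynomial identities in \<open>k\<close>.
\<close>

section \<open>Finite sums and binomial coefficients for the component form of the Jacobi
  identity\<close>

lemma Sum_any_eq_sum:
  assumes "\<And>i::nat. i \<ge> N \<Longrightarrow> g i = 0"
  shows "Sum_any g = sum g {..<N}"
  by (rule Sum_any.expand_superset) (use assms not_less in auto)

text \<open>Together with the next lemma this gives the coefficients in the modes of
  \<open>u_(-1) v\<close> and \<open>u_(-2) v\<close>.\<close>

lemma gchoose_minus_1: "(-1) ^ i * ((-1::complex) gchoose i) = 1"
  by (simp add: gbinomial_minus binomial_gbinomial[symmetric] flip: power_add mult.assoc)

lemma gchoose_minus_2: "(-1) ^ i * ((-2::complex) gchoose i) = of_nat i + 1"
proof -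
  have "((-2::complex) gchoose i) = (-1) ^ i * ((of_nat (Suc i)) gchoose i)"
    using gbinomial_minus[of "2::complex" i] by (simp add: add.commute)
  also have "(of_nat (Suc i) :: complex) gchoose i = of_nat (Suc i)"
    by (simp only: binomial_gbinomial[symmetric] binomial_Suc_n)
  finally show ?thesis
    by (simp flip: power_add mult.assoc)
qed

section \<open>Consequences of the Borcherds identity\<close>

context vertex_algebra
begin

abbreviation functional :: "('v \<Rightarrow> complex) \<Rightarrow> bool" where
  "functional \<equiv> Vector_Spaces.linear (scal V) (*)"

lemma nprod_right_simps [simp]:
  "nprod V u n (v + w) = nprod V u n v + nprod V u n w"
  "nprod V u n (v - w) = nprod V u n v - nprod V u n w"
  "nprod V u n (- v) = - nprod V u n v"
  "nprod V u n 0 = 0"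
  "nprod V u n (scal V c v) = scal V c (nprod V u n v)"
  "nprod V u n (sum g A) = (\<Sum>i\<in>A. nprod V u n (g i))"
proof -
  interpret l: Vector_Spaces.linear "scal V" "scal V" "\<lambda>v. nprod V u n v"
    by (rule linear_right)
  show "nprod V u n (v + w) = nprod V u n v + nprod V u n w"
    "nprod V u n (v - w) = nprod V u n v - nprod V u n w"
    "nprod V u n (- v) = - nprod V u n v"
    "nprod V u n 0 = 0"
    "nprod V u n (scal V c v) = scal V c (nprod V u n v)"
    "nprod V u n (sum g A) = (\<Sum>i\<in>A. nprod V u n (g i))"
    by (fact l.add l.diff l.neg l.zero l.scale l.sum)+
qed

lemma nprod_left_simps [simp]:
  "nprod V (u + v) n w = nprod V u n w + nprod V v n w"
  "nprod V (u - v) n w = nprod V u n w - nprod V v n w"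
  "nprod V (- u) n w = - nprod V u n w"
  "nprod V 0 n w = 0"
  "nprod V (scal V c u) n w = scal V c (nprod V u n w)"
proof -
  interpret l: Vector_Spaces.linear "scal V" "scal V" "\<lambda>u. nprod V u n w"
    by (rule linear_left)
  show "nprod V (u + v) n w = nprod V u n w + nprod V v n w"
    "nprod V (u - v) n w = nprod V u n w - nprod V v n w"
    "nprod V (- u) n w = - nprod V u n w"
    "nprod V 0 n w = 0"
    "nprod V (scal V c u) n w = scal V c (nprod V u n w)"
    by (fact l.add l.diff l.neg l.zero l.scale)+
qed

lemma functional_simps [simp]:
  assumes "functional \<phi>"
  shows "\<phi> (v + w) = \<phi> v + \<phi> w" "\<phi> (v - w) = \<phi> v - \<phi> w" "\<phi> (- v) = - \<phi> v" "\<phi> 0 = 0"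
    "\<phi> (scal V c v) = c * \<phi> v" "\<phi> (sum g A) = (\<Sum>i\<in>A. \<phi> (g i))"
proof -
  interpret l: Vector_Spaces.linear "scal V" "(*)" \<phi> by (rule assms)
  show "\<phi> (v + w) = \<phi> v + \<phi> w" "\<phi> (v - w) = \<phi> v - \<phi> w" "\<phi> (- v) = - \<phi> v" "\<phi> 0 = 0"
    "\<phi> (scal V c v) = c * \<phi> v" "\<phi> (sum g A) = (\<Sum>i\<in>A. \<phi> (g i))"
    by (fact l.add l.diff l.neg l.zero l.scale l.sum)+
qed

lemma functional_comp_nprod: "functional \<phi> \<Longrightarrow> functional (\<lambda>v. \<phi> (nprod V u n v))"
  and functional_comp_nprod_left: "functional \<phi> \<Longrightarrow> functional (\<lambda>u. \<phi> (nprod V u n v))"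
  using Vector_Spaces.linear_compose[OF linear_right] Vector_Spaces.linear_compose[OF linear_left]
  by (force simp: comp_def)+

text \<open>A basis of \<open>S\<close> stays independent when \<open>x\<close> is added, so a
  functional may be prescribed as 1 at \<open>x\<close> and 0 on that basis. This makes membership
  in a subspace testable by functionals.\<close>

lemma separating_functional:
  assumes "subspace S" "x \<notin> S"
  obtains \<phi> where "functional \<phi>" "\<And>v. v \<in> S \<Longrightarrow> \<phi> v = 0" "\<phi> x \<noteq> 0"
proof -
  interpret p: vector_space_pair "scal V" "(*) :: complex \<Rightarrow> complex \<Rightarrow> complex"
    by unfold_locales (auto simp: algebra_simps)
  obtain B where B: "B \<subseteq> S" "independent B" "span B = S"
    by (metis assms(1) basis_exists span_subspace)
  have "independent (insert x B)"
    using B assms(2) by (simp add: independent_insert)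
  from p.linear_independent_extend[OF this, of "\<lambda>y. if y = x then 1 else 0"]
  obtain \<phi> where \<phi>: "functional \<phi>" "\<forall>y\<in>insert x B. \<phi> y = (if y = x then 1 else 0)"
    by blast
  have "\<phi> v = 0" if "v \<in> S" for v
  proof -
    have "v \<in> span B" using that B by simp
    then show ?thesis
    proof (induction rule: span_induct_alt)
      case base then show ?case using \<phi>(1) by simp
    next
      case (step c y z)
      moreover have "y \<noteq> x" using step(1) B(1) assms(2) by auto
      ultimately show ?case using \<phi> by simp
    qed
  qed
  then show thesis using that[of \<phi>] \<phi> by simp
qed

lemma eqI_functional:
  assumes "\<And>\<phi>. functional \<phi> \<Longrightarrow> \<phi> v = \<phi> w"
  shows "v = w"
proof (rule ccontr)
  assume "v \<noteq> w"
  then have "v - w \<notin> {0}" by simp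
  then obtain \<phi> where "functional \<phi>" "\<phi> (v - w) \<noteq> 0"
    using separating_functional[of "{0}"] subspace_single_0 by metis
  then show False using assms by simp
qed

text \<open>The case \<open>r = 0\<close> of the Borcherds identity, where
  \<open>0 gchoose i\<close> leaves only \<open>i = 0\<close> on the right.\<close>

lemma nprod_commutator:
  "nprod V u m (nprod V v n w) - nprod V v n (nprod V u m w)
     = Sum_any (\<lambda>i::nat. scal V (of_int m gchoose i) (nprod V (nprod V u (int i) v) (m + n - int i) w))"
proof -
  have "nprod V u m (nprod V v n w) - nprod V v n (nprod V u m w) =
    Sum_any (\<lambda>i::nat. scal V ((-1) ^ i * (of_int 0 gchoose i))
          (nprod V u (m + 0 - int i) (nprod V v (n + int i) w) -
           scal V ((-1) powi 0) (nprod V v (n + 0 - int i) (nprod V u (m + int i) w))))"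
    by (subst Sum_any_eq_sum[where N = 1]) (auto simp: gbinomial_0_left)
  then show ?thesis
    using borcherds[of m u 0 v n w] by simp
qed

text \<open>The case \<open>p = 0\<close> of the Borcherds identity, where only \<open>i = 0\<close>
  remains on the left.\<close>

lemma nprod_iterate:
  "nprod V (nprod V u r v) n w =
     Sum_any (\<lambda>i::nat. scal V ((-1) ^ i * (of_int r gchoose i))
       (nprod V u (r - int i) (nprod V v (n + int i) w) -
        scal V ((-1) powi r) (nprod V v (n + r - int i) (nprod V u (int i) w))))"
proof -
  have "nprod V (nprod V u r v) n w =
    Sum_any (\<lambda>i::nat. scal V (of_int 0 gchoose i)
          (nprod V (nprod V u (r + int i) v) (0 + n - int i) w))"
    by (subst Sum_any_eq_sum[where N = 1]) (auto simp: gbinomial_0_left)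
  then show ?thesis
    using borcherds[of 0 u r v n w] by simp
qed

lemma nprod_iterate_finite:
  obtains N where "nprod V (nprod V u r v) n w =
     (\<Sum>i<N. scal V ((-1) ^ i * (of_int r gchoose i))
       (nprod V u (r - int i) (nprod V v (n + int i) w) -
        scal V ((-1) powi r) (nprod V v (n + r - int i) (nprod V u (int i) w))))"
proof -
  obtain M1 M2 where M: "\<forall>j\<ge>M1. nprod V v j w = 0" "\<forall>j\<ge>M2. nprod V u j w = 0"
    using truncation by metis
  let ?N = "nat (max M2 (M1 - n))"
  have "nprod V v (n + int i) w = 0 \<and> nprod V u (int i) w = 0" if "i \<ge> ?N" for i
    using M that by (auto simp: nat_le_iff)
  then show thesis
    using that[of ?N] nprod_iterate[of u r v n w]
    by (subst (asm) Sum_any_eq_sum[where N = ?N]) auto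
qed

lemma nprod_translate: "nprod V (nprod V u (-2) (vacuum V)) n w = scal V (- of_int n) (nprod V u (n - 1) w)"
proof -
  let ?g = "\<lambda>i::nat. scal V ((-1) ^ i * (of_int (-2) gchoose i))
       (nprod V u (-2 - int i) (nprod V (vacuum V) (n + int i) w) -
        scal V ((-1) powi (-2)) (nprod V (vacuum V) (n + (-2) - int i) (nprod V u (int i) w)))"
  have g: "?g = (\<lambda>i. scal V (of_nat i + 1) ((if int i = - 1 - n then nprod V u (n - 1) w else 0)
     - (if int i = n - 1 then nprod V u (n - 1) w else 0)))"
    by (rule ext) (auto simp: vacuum_left gchoose_minus_2)
  have "Sum_any ?g = scal V (- of_int n) (nprod V u (n - 1) w)"
  proof (cases "n = 0")
    case True
    then show ?thesis unfolding g by (subst Sum_any_eq_sum[where N = 0]) auto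
  next
    case False
    \<comment> \<open>The only index with a nonzero summand: \<open>- 1 - n\<close> from the first
      term if \<open>n < 0\<close>, \<open>n - 1\<close> from the second if
      \<open>n > 0\<close>.\<close>
    define j where "j = nat (\<bar>n\<bar> - 1)"
    have "Sum_any ?g = sum ?g {j}"
      unfolding g
      by (rule Sum_any.expand_superset) (use False in \<open>auto simp: j_def split: if_splits\<close>)
    also have "\<dots> = scal V (- of_int n) (nprod V u (n - 1) w)"
      using False unfolding g j_def
      by (cases "n > 0") (auto simp: of_nat_nat)
    finally show ?thesis .
  qed
  then show ?thesis using nprod_iterate[of u "-2" "vacuum V" n w] by simp
qed

text \<open>The translation operator, \<open>L(-1)\<close> in a vertex operator algebra.\<close>

definition T :: "'v \<Rightarrow> 'v" where "T v = nprod V v (-2) (vacuum V)"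

lemma T_simps [simp]:
  "T (v + w) = T v + T w" "T (v - w) = T v - T w" "T (- v) = - T v" "T 0 = 0"
  "T (scal V c v) = scal V c (T v)" "T (vacuum V) = 0"
  by (simp_all add: T_def vacuum_left)

lemma functional_comp_T: "functional \<phi> \<Longrightarrow> functional (\<lambda>v. \<phi> (T v))"
  unfolding T_def by (rule functional_comp_nprod_left)

lemma T_nprod: "T (nprod V u n v) = nprod V u n (T v) - scal V (of_int n) (nprod V u (n - 1) v)"
proof -
  let ?g = "\<lambda>i::nat. scal V ((-1) ^ i * (of_int n gchoose i))
       (nprod V u (n - int i) (nprod V v (-2 + int i) (vacuum V)) -
        scal V ((-1) powi n) (nprod V v (-2 + n - int i) (nprod V u (int i) (vacuum V))))"
  have "Sum_any ?g = sum ?g {..<2}"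
    by (rule Sum_any_eq_sum) (simp add: creation_nonneg)
  then show ?thesis
    unfolding T_def nprod_iterate by (simp add: creation_nonneg numeral_2_eq_2 creation)
qed

end

section \<open>Degree and charge of words in the affine modes\<close>

fun sl2_charge :: "sl2_basis \<Rightarrow> int" where
  "sl2_charge ch = 0" | "sl2_charge ce = 1" | "sl2_charge cf = -1"

definition word_degree :: "affine_word \<Rightarrow> int" where
  "word_degree w = - sum_list (map snd w)"

text \<open>Half the eigenvalue of \<open>h(0)\<close> on the vector of the word.\<close>

definition word_charge :: "affine_word \<Rightarrow> int" where
  "word_charge w = sum_list (map (sl2_charge \<circ> fst) w)"

lemma word_degree_simps [simp]:
  "word_degree [] = 0" "word_degree (l # w) = word_degree w - snd l"
  "word_degree (v @ w) = word_degree v + word_degree w"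
  by (simp_all add: word_degree_def)

lemma word_charge_simps [simp]:
  "word_charge [] = 0" "word_charge (l # w) = sl2_charge (fst l) + word_charge w"
  "word_charge (v @ w) = word_charge v + word_charge w"
  by (simp_all add: word_charge_def)

lemma word_degree_mset: "mset v = mset w \<Longrightarrow> word_degree v = word_degree w"
  unfolding word_degree_def by (metis mset_map sum_mset_sum_list)

lemma word_charge_mset: "mset v = mset w \<Longrightarrow> word_charge v = word_charge w"
  unfolding word_charge_def by (metis mset_map sum_mset_sum_list)

text \<open>Every negative entry adds at least 1 to the degree, so two lists of equal length and
  total degree at most 5 have at most two entries each. This enumerates the charge-zero words in
  \<open>e\<close> and \<open>f\<close> of low degree.\<close>

lemma negative_lists_cases:
  assumes "\<forall>n\<in>set us \<union> set vs. n < (0::int)" "length us = length vs"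
    "- sum_list us - sum_list vs = d" "0 < d" "d \<le> 5"
  obtains m n where "us = [m]" "vs = [n]" "m < 0" "n < 0" "m + n = - d"
  | p q m n where "us = [p, q]" "vs = [m, n]" "p < 0" "q < 0" "m < 0" "n < 0" "p + q + m + n = - d"
proof -
  have len: "int (length xs) \<le> - sum_list xs" if "\<forall>n\<in>set xs. n < (0::int)" for xs
    using that by (induction xs) auto
  have "2 * int (length us) \<le> 5"
    using len[of us] len[of vs] assms by auto
  moreover have "length us \<noteq> 0" using assms by auto
  ultimately have "length us = 1 \<or> length us = 2" by linarith
  then show thesis
  proof
    assume l: "length us = 1"
    then obtain m n where "us = [m]" "vs = [n]"
      using assms(2) by (metis One_nat_def length_0_conv length_Suc_conv)
    then show thesis using that(1)[of m n] assms by simp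
  next
    assume l: "length us = 2"
    then obtain p q m n where "us = [p, q]" "vs = [m, n]"
      using assms(2) by (metis (no_types) One_nat_def Suc_1 length_0_conv length_Suc_conv)
    then show thesis using that(2)[of p q m n] assms by simp
  qed
qed

lemma negative_pair:
  fixes m n :: int
  shows "m < 0 \<Longrightarrow> n < 0 \<Longrightarrow> m + n = - 2 \<Longrightarrow> m = -1 \<and> n = -1"
    and "m < 0 \<Longrightarrow> n < 0 \<Longrightarrow> m + n = - 3 \<Longrightarrow> m = -1 \<and> n = -2 \<or> m = -2 \<and> n = -1"
    and "m < 0 \<Longrightarrow> n < 0 \<Longrightarrow> m + n = - 4 \<Longrightarrow> m = -1 \<and> n = -3 \<or> m = -2 \<and> n = -2 \<or> m = -3 \<and> n = -1"
    and "m < 0 \<Longrightarrow> n < 0 \<Longrightarrow> m + n = - 5 \<Longrightarrow>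
      m = -1 \<and> n = -4 \<or> m = -2 \<and> n = -3 \<or> m = -3 \<and> n = -2 \<or> m = -4 \<and> n = -1"
  by presburger+

lemma negative_quadruple:
  fixes m n p q :: int
  assumes "p < 0" "q < 0" "m < 0" "n < 0"
  shows "p + q + m + n = - 4 \<Longrightarrow> p = -1 \<and> q = -1 \<and> m = -1 \<and> n = -1"
    and "p + q + m + n = - 5 \<Longrightarrow> p = -2 \<and> q = -1 \<and> m = -1 \<and> n = -1 \<or> p = -1 \<and> q = -2 \<and> m = -1 \<and> n = -1
      \<or> p = -1 \<and> q = -1 \<and> m = -2 \<and> n = -1 \<or> p = -1 \<and> q = -1 \<and> m = -1 \<and> n = -2"
  using assms by presburger+

text \<open>
  The excluded levels are the zeros of the polynomials in \<open>k\<close> that occur below: \<open>0\<close> and \<open>-2\<close> in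
  denominators, \<open>1\<close> in the central charge, \<open>2\<close> and \<open>-4/3\<close> in the product \<open>W3_3 W3\<close>, \<open>-3/2\<close> and
  \<open>-4/3\<close> in the determinants that give the generators of weight 4 and 5.
\<close>

locale affine_sl2_vertex_algebra = vertex_algebra V
  for V :: "'v::ab_group_add vertex_structure" +
  fixes k :: complex and a :: "sl2_basis \<Rightarrow> 'v"
  assumes affine_commutator:
      "nprod V (a x) m (nprod V (a y) n v) - nprod V (a y) n (nprod V (a x) m v) =
         (\<Sum>z\<in>{ch, ce, cf}. scal V (sl2_bracket x y z) (nprod V (a z) (m + n) v))
         + scal V (if m + n = 0 then of_int m * sl2_form x y * k else 0) v"
    and span_words: "span (range (word_vector V a)) = UNIV"
    and vacuum_nonzero: "vacuum V \<noteq> 0"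
    and level: "k \<noteq> 0" "k \<noteq> 1" "k \<noteq> 2" "k \<noteq> -2" "3 * k + 4 \<noteq> 0" "2 * k + 3 \<noteq> 0"
begin

abbreviation h where "h n \<equiv> nprod V (a ch) n"
abbreviation e where "e n \<equiv> nprod V (a ce) n"
abbreviation f where "f n \<equiv> nprod V (a cf) n"
abbreviation vac where "vac \<equiv> vacuum V"

abbreviation act :: "affine_word \<Rightarrow> 'v \<Rightarrow> 'v" where
  "act w \<equiv> foldr (\<lambda>l. nprod V (a (fst l)) (snd l)) w"

lemma word_vector_eq_act: "word_vector V a w = act w vac"
  by (induction w) auto

lemma functional_comp_act: "functional \<phi> \<Longrightarrow> functional (\<lambda>v. \<phi> (act w v))"
proof (induction w arbitrary: \<phi>)
  case (Cons l w)
  then show ?case using Cons.IH[of "\<lambda>v. \<phi> (nprod V (a (fst l)) (snd l) v)"] functional_comp_nprod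
    by auto
qed auto

lemma functional_zero_on_words:
  assumes "functional \<phi>" "\<And>w. \<phi> (act w vac) = 0"
  shows "\<phi> v = 0"
proof -
  have "v \<in> span (range (word_vector V a))" using span_words by simp
  then show ?thesis
    by (induction rule: span_induct_alt) (use assms in \<open>auto simp: word_vector_eq_act\<close>)
qed

section \<open>Reordering words\<close>

text \<open>
  Commutators only produce shorter words of the same degree and charge.  A functional that
  kills these does not see the order of the letters, which gives an induction on the length.
\<close>

definition kills_shorter :: "('v \<Rightarrow> complex) \<Rightarrow> affine_word \<Rightarrow> bool" where
  "kills_shorter \<phi> w \<longleftrightarrow> (\<forall>w'. length w' < length w \<longrightarrow> word_degree w' = word_degree w \<longrightarrow>
     word_charge w' = word_charge w \<longrightarrow> \<phi> (act w' vac) = 0)"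

lemma kills_shorter_mset: "kills_shorter \<phi> v \<Longrightarrow> mset v = mset w \<Longrightarrow> kills_shorter \<phi> w"
  unfolding kills_shorter_def
  by (metis mset_eq_length word_degree_mset word_charge_mset)

lemma sl2_bracket_charge: "sl2_bracket x y z \<noteq> 0 \<Longrightarrow> sl2_charge z = sl2_charge x + sl2_charge y"
  by (cases x; cases y; cases z) auto

lemma sl2_form_charge: "sl2_form x y \<noteq> 0 \<Longrightarrow> sl2_charge x + sl2_charge y = 0"
  by (cases x; cases y) auto

text \<open>The commutator contributes words shorter by one letter (bracket) or by two (central
  term). Bracket and form respect the charge, so \<open>\<phi>\<close> kills all of them.\<close>

lemma swap_adjacent:
  assumes "functional \<phi>" "kills_shorter \<phi> (u @ l # l' # w)"
  shows "\<phi> (act (u @ l # l' # w) vac) = \<phi> (act (u @ l' # l # w) vac)"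
proof -
  obtain x m y n where l: "l = (x, m)" "l' = (y, n)" by (cases l; cases l')
  let ?\<psi> = "\<lambda>v. \<phi> (act u v)" and ?v = "act w vac"
  have \<psi>: "functional ?\<psi>" using assms(1) by (rule functional_comp_act)
  have b: "sl2_bracket x y z * ?\<psi> (nprod V (a z) (m + n) ?v) = 0" for z
  proof (cases "sl2_bracket x y z = 0")
    case False
    then have "\<phi> (act (u @ (z, m + n) # w) vac) = 0"
      using assms(2)[unfolded kills_shorter_def, rule_format, of "u @ (z, m + n) # w"]
        sl2_bracket_charge[OF False] by (simp add: l)
    then show ?thesis by simp
  qed simp
  have c: "(if m + n = 0 then of_int m * sl2_form x y * k else 0) * ?\<psi> ?v = 0"
  proof (cases "m + n = 0 \<and> sl2_form x y \<noteq> 0")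
    case True
    then have "\<phi> (act (u @ w) vac) = 0"
      using assms(2)[unfolded kills_shorter_def, rule_format, of "u @ w"]
        sl2_form_charge[of x y] by (simp add: l)
    then show ?thesis by simp
  qed auto
  have "?\<psi> (nprod V (a x) m (nprod V (a y) n ?v) - nprod V (a y) n (nprod V (a x) m ?v)) =
    (\<Sum>z\<in>{ch, ce, cf}. sl2_bracket x y z * ?\<psi> (nprod V (a z) (m + n) ?v))
    + (if m + n = 0 then of_int m * sl2_form x y * k else 0) * ?\<psi> ?v"
    unfolding affine_commutator by (simp only: functional_simps[OF \<psi>])
  also have "\<dots> = 0" unfolding b c by simp
  finally show ?thesis by (simp add: l functional_simps[OF \<psi>])
qed

lemma move_letter:
  assumes "functional \<phi>" "kills_shorter \<phi> (u @ s @ l # w)"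
  shows "\<phi> (act (u @ s @ l # w) vac) = \<phi> (act (u @ l # s @ w) vac)"
  using assms
proof (induction s arbitrary: u)
  case (Cons x s)
  have "\<phi> (act (u @ (x # s) @ l # w) vac) = \<phi> (act (u @ x # l # s @ w) vac)"
    using Cons.IH[of "u @ [x]"] Cons.prems by simp
  also have "\<dots> = \<phi> (act (u @ l # x # s @ w) vac)"
    by (rule swap_adjacent) (use Cons.prems in \<open>auto elim!: kills_shorter_mset\<close>)
  finally show ?case by simp
qed simp

text \<open>The first letter of \<open>v\<close> is located in \<open>w\<close> and moved to its
  front; the general prefix \<open>u\<close> then absorbs it, and the induction continues with the
  rest.\<close>

lemma reorder_word:
  assumes "functional \<phi>" "kills_shorter \<phi> (u @ v)" "mset v = mset w"
  shows "\<phi> (act (u @ v) vac) = \<phi> (act (u @ w) vac)"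
  using assms
proof (induction v arbitrary: u w)
  case (Cons l v)
  then obtain s t where w: "w = s @ l # t"
    by (metis list.set_intros(1) set_mset_mset split_list)
  have "\<phi> (act (u @ l # v) vac) = \<phi> (act (u @ l # s @ t) vac)"
    using Cons.IH[of "u @ [l]" "s @ t"] Cons.prems w by simp
  also have "\<dots> = \<phi> (act (u @ s @ l # t) vac)"
    by (rule move_letter[symmetric]) (use Cons.prems w in \<open>auto elim!: kills_shorter_mset\<close>)
  finally show ?case using w by simp
qed simp

text \<open>The annihilation letter may be moved to the right end, where it meets the
  vacuum.\<close>

lemma act_annihilates:
  assumes "functional \<phi>" "kills_shorter \<phi> w" "(x, n) \<in> set w" "n \<ge> 0"
  shows "\<phi> (act w vac) = 0"
proof -
  have "\<phi> (act w vac) = \<phi> (act (remove1 (x, n) w @ [(x, n)]) vac)"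
    using reorder_word[of \<phi> "[]" w "remove1 (x, n) w @ [(x, n)]"] assms by simp
  also have "act (remove1 (x, n) w @ [(x, n)]) vac = act (remove1 (x, n) w) 0"
    using assms(4) by (simp add: creation_nonneg)
  also have "\<phi> (act (remove1 (x, n) w) 0) = 0"
    using functional_simps(4)[OF functional_comp_act[OF assms(1)]] .
  finally show ?thesis .
qed

text \<open>A word of negative degree contains an annihilation letter, and by induction on the
  length the shorter words of this degree vanish, so \<open>act_annihilates\<close> applies.\<close>

lemma negative_degree:
  assumes "word_degree w < 0"
  shows "act w vac = 0"
proof (rule eqI_functional)
  fix \<phi> assume \<phi>: "functional \<phi>"
  have "\<phi> (act w vac) = 0" using assms
  proof (induction "length w" arbitrary: w rule: less_induct)
    case less
    have "\<exists>l\<in>set w. snd l \<ge> 0"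
    proof (rule ccontr)
      assume "\<not> ?thesis"
      then have "sum_list (map snd w) \<le> 0" by (intro sum_list_nonpos) auto
      then show False using less.prems by (simp add: word_degree_def)
    qed
    moreover have "kills_shorter \<phi> w"
      using less unfolding kills_shorter_def by metis
    ultimately show ?case using act_annihilates[OF \<phi>] by force
  qed
  then show "\<phi> (act w vac) = \<phi> 0" using \<phi> by simp
qed

definition H :: "'v set" where "H = span {h n v |n v. n < 0}"

lemma subspace_H: "subspace H" unfolding H_def by simp

lemma h_in_H: "n < 0 \<Longrightarrow> h n v \<in> H" unfolding H_def by (blast intro: span_base)

text \<open>In dual form: modulo \<open>H\<close>, \<open>V\<close> is spanned by the words in the creation modes of \<open>e\<close> followed by those of \<open>f\<close>.\<close>

lemma spanning_mod_H:
  assumes "functional \<phi>" "\<And>v. v \<in> H \<Longrightarrow> \<phi> v = 0"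
    and ef: "\<And>us vs. \<forall>n\<in>set us \<union> set vs. n < 0 \<Longrightarrow> int (length us) - int (length vs) = q \<Longrightarrow>
          - sum_list us - sum_list vs = d \<Longrightarrow>
          \<phi> (act (map (Pair ce) us @ map (Pair cf) vs) vac) = 0"
    and "word_degree w = d" "word_charge w = q"
  shows "\<phi> (act w vac) = 0"
  using assms(4,5)
proof (induction "length w" arbitrary: w rule: less_induct)
  case less
  then have ks: "kills_shorter \<phi> w"
    unfolding kills_shorter_def by blast
  \<comment> \<open>Either an annihilation letter can be moved to the vacuum, or a creation letter
    of \<open>h\<close> can be moved to the front and gives an element of \<open>H\<close>, or only
    creation letters of \<open>e\<close> and \<open>f\<close> occur.\<close>
  consider x n where "(x, n) \<in> set w" "n \<ge> 0" | n where "(ch, n) \<in> set w" "n < 0"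
    | "\<forall>l\<in>set w. fst l \<noteq> ch \<and> snd l < 0"
    by (metis linorder_not_less prod.collapse)
  then show ?case
  proof cases
    case 1
    then show ?thesis using act_annihilates[OF assms(1) ks] by blast
  next
    case 2
    then have "\<phi> (act w vac) = \<phi> (act ((ch, n) # remove1 (ch, n) w) vac)"
      using reorder_word[of \<phi> "[]" w "(ch, n) # remove1 (ch, n) w"] ks assms(1) by simp
    then show ?thesis using assms(2) h_in_H[OF 2(2)] by simp
  next
    case 3
    define us vs where "us = map snd (filter (\<lambda>l. fst l = ce) w)"
      and "vs = map snd (filter (\<lambda>l. fst l = cf) w)"
    have "map (Pair ce) us = filter (\<lambda>l. fst l = ce) w"
      unfolding us_def by (induction w) auto
    moreover have "map (Pair cf) vs = filter (\<lambda>l. fst l = cf) w"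
      unfolding vs_def by (induction w) auto
    moreover have "filter (\<lambda>l. fst l = cf) w = filter (\<lambda>l. fst l \<noteq> ce) w"
      using 3 by (intro filter_cong) (metis sl2_basis.exhaust sl2_basis.distinct(5))+
    ultimately have m: "mset w = mset (map (Pair ce) us @ map (Pair cf) vs)"
      by simp
    have "\<phi> (act w vac) = \<phi> (act (map (Pair ce) us @ map (Pair cf) vs) vac)"
      using reorder_word[of \<phi> "[]", OF assms(1) _ m] ks by simp
    also have "\<dots> = 0"
    proof (rule ef)
      show "\<forall>n\<in>set us \<union> set vs. n < 0" using 3 by (auto simp: us_def vs_def)
      have c: "word_charge (map (Pair x) us) = int (length us) * sl2_charge x" for x us
        by (induction us) (auto simp: algebra_simps)
      show "int (length us) - int (length vs) = q"
        using word_charge_mset[OF m] less.prems by (simp add: c)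
      have "word_degree (map (Pair x) us) = - sum_list us" for x us
        by (induction us) auto
      then show "- sum_list us - sum_list vs = d"
        using word_degree_mset[OF m] less.prems by simp
    qed
    finally show ?thesis .
  qed
qed


section \<open>The commutant of the Heisenberg subalgebra\<close>

abbreviation N :: "'v set" where "N \<equiv> heisenberg_commutant V a"

lemma h_h_commute:
  "h m (h n v) = h n (h m v) + (if m + n = 0 then scal V (2 * of_int m * k) v else 0)"
  using affine_commutator[of ch m ch n v] by (simp add: algebra_simps split: if_splits)

lemma h_funpow_degree: "word_degree (replicate j (ch, n)) = - int j * n"
  by (induction j) (auto simp: algebra_simps)

lemma act_replicate: "act (replicate j (ch, n)) v = (h n ^^ j) v"
  by (induction j) auto

lemma h_funpow_zero: "(h n ^^ j) 0 = 0"
  by (induction j) auto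

text \<open>Each application of \<open>h(n)\<close> lowers the degree by \<open>n\<close>, and words
  of negative degree vanish.\<close>

lemma h_locally_nilpotent:
  assumes "n > 0"
  shows "\<exists>J. \<forall>j\<ge>J. (h n ^^ j) v = 0"
proof -
  have "v \<in> span (range (word_vector V a))" using span_words by simp
  then show ?thesis
  proof (induction rule: span_induct_alt)
    case base
    show ?case by (blast intro: h_funpow_zero)
  next
    case (step c x y)
    then obtain w J where w: "x = act w vac" and J: "\<forall>j\<ge>J. (h n ^^ j) y = 0"
      by (auto simp: word_vector_eq_act)
    have lin: "(h n ^^ j) (scal V c x + y) = scal V c ((h n ^^ j) x) + (h n ^^ j) y" for j
      by (induction j) auto
    have "(h n ^^ j) x = 0" if "j \<ge> nat (word_degree w + 1)" for j
    proof -
      have "word_degree w < int j" using that by simp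
      also have "int j \<le> int j * n" using assms mult_left_mono[of 1 n "int j"] by simp
      finally have "act (replicate j (ch, n) @ w) vac = 0"
        by (intro negative_degree) (simp add: h_funpow_degree)
      then show ?thesis by (simp add: w act_replicate)
    qed
    then have "\<forall>j\<ge>max J (nat (word_degree w + 1)). (h n ^^ j) (scal V c x + y) = 0"
      using J by (simp add: lin)
    then show ?case by blast
  qed
qed

text \<open>
  For \<open>n > 0\<close> put \<open>c = 2nk\<close>, so that \<open>[h(n), h(-n)] = c\<close>.  The operator
  \<open>\<Sum>j. (-1)^j / (j! c^j) h(-n)^j h(n)^j\<close> is the identity on the kernel of \<open>h(n)\<close> and
  kills the image of \<open>h(-n)\<close>.
\<close>

definition heis_proj :: "int \<Rightarrow> 'v \<Rightarrow> 'v" where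
  "heis_proj n v = Sum_any (\<lambda>j::nat. scal V ((-1) ^ j / (fact j * (2 * of_int n * k) ^ j))
     ((h (-n) ^^ j) ((h n ^^ j) v)))"

lemma heis_proj_finite:
  assumes "\<forall>j\<ge>J. (h n ^^ j) v = 0"
  shows "heis_proj n v = (\<Sum>j<J. scal V ((-1) ^ j / (fact j * (2 * of_int n * k) ^ j))
     ((h (-n) ^^ j) ((h n ^^ j) v)))"
  unfolding heis_proj_def using assms by (intro Sum_any_eq_sum) (simp add: h_funpow_zero)

lemma h_funpow_add: "(h n ^^ j) (v + w) = (h n ^^ j) v + (h n ^^ j) w"
  by (induction j) auto

lemma h_funpow_scale: "(h n ^^ j) (scal V c v) = scal V c ((h n ^^ j) v)"
  by (induction j) auto

lemma heis_proj_add: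
  assumes "n > 0"
  shows "heis_proj n (v + w) = heis_proj n v + heis_proj n w"
proof -
  obtain J1 J2 where "\<forall>j\<ge>J1. (h n ^^ j) v = 0" "\<forall>j\<ge>J2. (h n ^^ j) w = 0"
    using h_locally_nilpotent[OF assms] by metis
  then have "\<forall>j\<ge>max J1 J2. (h n ^^ j) v = 0" "\<forall>j\<ge>max J1 J2. (h n ^^ j) w = 0"
    "\<forall>j\<ge>max J1 J2. (h n ^^ j) (v + w) = 0"
    by (auto simp: h_funpow_add)
  from this[THEN heis_proj_finite] show ?thesis
    by (simp add: h_funpow_add scale_right_distrib sum.distrib)
qed

lemma heis_proj_fixes: "n > 0 \<Longrightarrow> h n v = 0 \<Longrightarrow> heis_proj n v = v"
proof -
  assume "n > 0" "h n v = 0"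
  then have "(h n ^^ j) v = 0" if "j \<ge> 1" for j
    using that
  proof (induction j)
    case (Suc j) then show ?case by (cases "j = 0") auto
  qed simp
  then show ?thesis using heis_proj_finite[of 1 n v] by auto
qed

text \<open>Iterating \<open>[h(n), h(-n)] = 2nk\<close>. At \<open>j = 0\<close> the truncated
  \<open>j - 1\<close> is harmless, as its coefficient is 0.\<close>

lemma h_funpow_commute:
  "(h n ^^ j) (h (-n) v) = h (-n) ((h n ^^ j) v) + scal V (of_nat j * (2 * of_int n * k)) ((h n ^^ (j - 1)) v)"
proof (induction j)
  case (Suc j)
  have "h n ((h n ^^ (j - 1)) v) = (h n ^^ j) v" if "j \<noteq> 0"
    using that by (cases j) auto
  then show ?case
    using Suc h_h_commute[of n "-n" "(h n ^^ j) v"]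
    by (cases "j = 0") (auto simp: algebra_simps simp flip: scale_left_distrib)
qed simp

text \<open>Commuting \<open>h(-n)\<close> to the left splits the summand of index
  \<open>j > 0\<close> into \<open>F j - F (j - 1)\<close>. The sum telescopes to a term that
  contains a vanishing power of \<open>h(n)\<close>.\<close>

lemma heis_proj_kills:
  assumes "n > 0"
  shows "heis_proj n (h (-n) v) = 0"
proof -
  obtain J where J: "\<forall>j\<ge>J. (h n ^^ j) v = 0"
    using h_locally_nilpotent[OF assms] by blast
  define c where "c = 2 * of_int n * k"
  have c: "c \<noteq> 0" using assms level(1) by (simp add: c_def)
  define F where "F j = scal V ((-1) ^ j / (fact j * c ^ j)) ((h (-n) ^^ Suc j) ((h n ^^ j) v))" for j
  have up: "(h (-n) ^^ j) (h (-n) u) = (h (-n) ^^ Suc j) u" for j u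
    by (metis comp_apply funpow_Suc_right)
  have t: "scal V ((-1) ^ Suc j / (fact (Suc j) * c ^ Suc j)) ((h (-n) ^^ Suc j) ((h n ^^ Suc j) (h (-n) v)))
    = F (Suc j) - F j" for j
  proof -
    have q: "(-1) ^ Suc j / (fact (Suc j) * c ^ Suc j) * (of_nat (Suc j) * c) = - ((-1) ^ j / (fact j * c ^ j))"
      using c by (simp add: divide_simps del: of_nat_Suc)
    show ?thesis
      unfolding h_funpow_commute c_def[symmetric] h_funpow_add h_funpow_scale up scale_right_distrib
        scale_scale q F_def diff_Suc_1 scale_minus_left by (simp add: scale_right_distrib)
  qed
  \<comment> \<open>Commuting leaves the power \<open>j - 1\<close>, so the bound \<open>J\<close>
    for \<open>v\<close> has to be raised.\<close>
  have "\<forall>j\<ge>J + 2. (h n ^^ j) (h (-n) v) = 0"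
    using J unfolding h_funpow_commute by auto
  then have "heis_proj n (h (-n) v) = (\<Sum>j<Suc (J + 1). scal V ((-1) ^ j / (fact j * c ^ j))
     ((h (-n) ^^ j) ((h n ^^ j) (h (-n) v))))"
    using heis_proj_finite c_def by simp
  also have "\<dots> = F 0 + (\<Sum>j<J + 1. F (Suc j) - F j)"
    unfolding sum.lessThan_Suc_shift t by (simp add: F_def)
  also have "\<dots> = F (J + 1)"
    unfolding sum_lessThan_telescope by simp
  also have "\<dots> = 0"
    using J by (simp add: F_def h_funpow_zero del: funpow.simps)
  finally show ?thesis .
qed

lemma heis_proj_commute:
  assumes "n > 0" "m \<noteq> n" "m \<noteq> -n"
  shows "heis_proj n (h m v) = h m (heis_proj n v)"
proof -
  have c: "(h p ^^ j) (h m v) = h m ((h p ^^ j) v)" if "p + m \<noteq> 0" for p j v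
    by (induction j) (use that h_h_commute[of p m] in auto)
  obtain J where J: "\<forall>j\<ge>J. (h n ^^ j) v = 0"
    using h_locally_nilpotent[OF assms(1)] by blast
  then have "\<forall>j\<ge>J. (h n ^^ j) (h m v) = 0"
    using c assms by simp
  from heis_proj_finite[OF this] heis_proj_finite[OF J] show ?thesis
    using assms by (simp add: c)
qed

text \<open>Write \<open>v\<close> as a sum of \<open>h(-i) g_i\<close> with
  \<open>1 \<le> i \<le> M\<close>. The operator \<open>heis_proj M\<close> fixes \<open>v\<close>,
  kills the last summand and commutes with the other \<open>h(-i)\<close>, so \<open>M\<close> drops
  by one; at \<open>M = 0\<close> the sum is empty.\<close>

lemma N_Int_H:
  assumes "v \<in> N" "v \<in> H"
  shows "v = 0"
proof -
  have "\<exists>M g. v = (\<Sum>i<M. h (- int (Suc i)) (g i))"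
    using assms(2) unfolding H_def
  proof (induction rule: span_induct_alt)
    case base
    have "0 = (\<Sum>i<0. h (- int (Suc i)) 0)" by simp
    then show ?case by (intro exI)
  next
    case (step c x y)
    then obtain n u M g where x: "x = h n u" "n < 0" and y: "y = (\<Sum>i<M. h (- int (Suc i)) (g i))"
      by blast
    \<comment> \<open>Mode \<open>n\<close> has position \<open>i0\<close>, since
      \<open>n = - int (Suc i0)\<close>; both families are padded with zeros to a common
      length.\<close>
    define i0 where "i0 = nat (- n - 1)"
    define g1 where "g1 i = (if i < M then g i else 0)" for i
    define g2 where "g2 i = (if i = i0 then scal V c u else 0)" for i
    have "y = (\<Sum>i<M + Suc i0. h (- int (Suc i)) (g1 i))"
      unfolding y g1_def by (rule sum.mono_neutral_cong_left) auto
    moreover have "scal V c x = (\<Sum>i<M + Suc i0. h (- int (Suc i)) (g2 i))"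
    proof -
      have "(\<Sum>i<M + Suc i0. h (- int (Suc i)) (g2 i)) = (\<Sum>i\<in>{i0}. h (- int (Suc i)) (g2 i))"
        by (rule sum.mono_neutral_right) (auto simp: g2_def)
      then show ?thesis using x by (simp add: g2_def i0_def)
    qed
    ultimately have "scal V c x + y = (\<Sum>i<M + Suc i0. h (- int (Suc i)) (g2 i + g1 i))"
      by (simp add: sum.distrib)
    then show ?case by (intro exI)
  qed
  then obtain M g where "v = (\<Sum>i<M. h (- int (Suc i)) (g i))" by blast
  then show ?thesis
  proof (induction M arbitrary: g)
    case (Suc M)
    let ?P = "heis_proj (int (Suc M))"
    have s: "?P (\<Sum>i<m. u i) = (\<Sum>i<m. ?P (u i))" for m :: nat and u
      by (induction m) (simp_all add: heis_proj_fixes heis_proj_add)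
    have "v = ?P v"
      using assms(1) heis_proj_fixes[of "int (Suc M)" v] by (simp add: heisenberg_commutant_def)
    also have "\<dots> = (\<Sum>i<Suc M. ?P (h (- int (Suc i)) (g i)))"
      using Suc.prems s by metis
    also have "\<dots> = (\<Sum>i<M. ?P (h (- int (Suc i)) (g i)))"
      using heis_proj_kills[of "int (Suc M)" "g M"] by simp
    also have "\<dots> = (\<Sum>i<M. h (- int (Suc i)) (?P (g i)))"
      by (intro sum.cong refl heis_proj_commute) auto
    finally show ?case by (rule Suc.IH)
  qed simp
qed

lemma subspace_N: "subspace N"
  by (rule subspaceI) (auto simp: heisenberg_commutant_def)

text \<open>The commutator of \<open>h(m)\<close> with a mode of \<open>u\<close> involves only the
  vectors \<open>h(i) u\<close> with \<open>i \<ge> 0\<close>, and these vanish for \<open>u\<close>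
  in \<open>N\<close>.\<close>

lemma vertex_subalgebra_N: "vertex_subalgebra V N"
  unfolding vertex_subalgebra_def
proof (intro conjI ballI allI)
  show "vac \<in> N" by (simp add: heisenberg_commutant_def creation_nonneg)
  fix u v n assume u: "u \<in> N" and v: "v \<in> N"
  have "h m (nprod V u n v) = 0" if "m \<ge> 0" for m
  proof -
    have "h m (nprod V u n v) - nprod V u n (h m v) = 0"
      unfolding nprod_commutator using u by (simp add: heisenberg_commutant_def)
    then show ?thesis using v that by (simp add: heisenberg_commutant_def)
  qed
  then show "nprod V u n v \<in> N" by (simp add: heisenberg_commutant_def)
qed (rule subspace_N)

lemma N_nprod: "u \<in> N \<Longrightarrow> v \<in> N \<Longrightarrow> nprod V u n v \<in> N"
  using vertex_subalgebra_N by (simp add: vertex_subalgebra_def)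

lemma T_in_H: "v \<in> H \<Longrightarrow> T v \<in> H"
  unfolding H_def
proof (induction rule: span_induct_alt)
  case (step c x y)
  then obtain n u where x: "x = h n u" "n < 0" by blast
  have "T x \<in> H"
    unfolding x T_nprod using x(2)
    by (intro subspace_diff[OF subspace_H] subspace_scale[OF subspace_H] h_in_H) auto
  then show ?case using step(2) subspace_H by (simp add: H_def span_add span_scale)
qed (simp add: span_zero)

text \<open>
  In \<open>(h(r)w)_n v\<close> every term has, after normal ordering, either a creation mode of \<open>h\<close> on the
  left or an annihilation mode of \<open>h\<close> next to \<open>v\<close>.
\<close>

lemma h_iterate_in_H:
  assumes "v \<in> N" "r < 0"
  shows "nprod V (h r w) n v \<in> H"
proof -
  obtain M where *: "nprod V (h r w) n v =
     (\<Sum>i<M. scal V ((-1) ^ i * (of_int r gchoose i))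
       (h (r - int i) (nprod V w (n + int i) v) -
        scal V ((-1) powi r) (nprod V w (n + r - int i) (h (int i) v))))"
    by (rule nprod_iterate_finite)
  show ?thesis unfolding *
    by (intro subspace_sum[OF subspace_H] subspace_scale[OF subspace_H])
      (use assms in \<open>auto simp: heisenberg_commutant_def intro: h_in_H\<close>)
qed

end

text \<open>Applying \<open>D - l j\<close> removes the summand \<open>y j\<close> and multiplies
  the sum by \<open>c - l j\<close>, which is nonzero; the rest is induction.\<close>

lemma eigenvectors_sum_zero:
  assumes "finite A" "vector_space scale" "Vector_Spaces.linear scale scale D"
    and "\<And>i. i \<in> A \<Longrightarrow> D (y i) = scale (l i) (y i)" "\<And>i. i \<in> A \<Longrightarrow> l i \<noteq> c"
    and "D (sum y A) = scale c (sum y A)"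
  shows "sum y A = 0"
  using assms(1,4,5,6)
proof (induction A arbitrary: y)
  case (insert j A)
  interpret vector_space scale by (rule assms(2))
  interpret D: Vector_Spaces.linear scale scale D by (rule assms(3))
  let ?s = "sum y (insert j A)"
  define z where "z i = scale (l i - l j) (y i)" for i
  have "scale (c - l j) ?s = (\<Sum>i\<in>insert j A. z i)"
    using insert.prems by (simp add: z_def D.sum scale_left_diff_distrib scale_sum_right sum_subtractf)
  also have "\<dots> = sum z A"
    using insert.hyps by (simp add: z_def)
  finally have sz: "sum z A = scale (c - l j) ?s" by simp
  have "sum z A = 0"
  proof (rule insert.IH)
    show "D (z i) = scale (l i) (z i)" if "i \<in> A" for i
      using insert.prems(1)[of i] that by (simp add: z_def D.scale mult.commute)
    show "l i \<noteq> c" if "i \<in> A" for i using insert.prems(2) that by simp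
    show "D (sum z A) = scale c (sum z A)"
      unfolding sz D.scale insert.prems(3) by (simp add: mult.commute)
  qed
  then show ?case using sz insert.prems(2)[of j] by simp
qed simp

context affine_sl2_vertex_algebra
begin

abbreviation \<omega> where "\<omega> \<equiv> parafermion_omega V k a"
abbreviation W3 where "W3 \<equiv> parafermion_W3 V k a"

text \<open>
  Used for rewriting: annihilation modes move to the right, creation modes into the order
  \<open>h\<close>, \<open>e\<close>, \<open>f\<close>.  The summand \<open>0\<close> keeps the simplifier from treating a rule as permutative.
\<close>

lemma word_rules:
  "n < 0 \<Longrightarrow> n < m \<Longrightarrow> h m (h n v) = h n (h m v) + (if m + n = 0 then scal V (2 * of_int m * k) v else 0)"
  "n < 0 \<Longrightarrow> 0 \<le> m \<Longrightarrow> h m (e n v) = e n (h m v) + scal V 2 (e (m + n) v)"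
  "n < 0 \<Longrightarrow> 0 \<le> m \<Longrightarrow> h m (f n v) = f n (h m v) - scal V 2 (f (m + n) v)"
  "n < 0 \<Longrightarrow> e m (h n v) = h n (e m v) - scal V 2 (e (m + n) v)"
  "n < 0 \<Longrightarrow> f m (h n v) = h n (f m v) + scal V 2 (f (m + n) v)"
  "n < 0 \<Longrightarrow> n < m \<Longrightarrow> e m (e n v) = e n (e m v) + 0"
  "n < 0 \<Longrightarrow> n < m \<Longrightarrow> f m (f n v) = f n (f m v) + 0"
  "n < 0 \<Longrightarrow> 0 \<le> m \<Longrightarrow> e m (f n v) =
     f n (e m v) + h (m + n) v + (if m + n = 0 then scal V (of_int m * k) v else 0)"
  "n < 0 \<Longrightarrow> f m (e n v) =
     e n (f m v) - h (m + n) v + (if m + n = 0 then scal V (of_int m * k) v else 0)"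
  "0 \<le> m \<Longrightarrow> nprod V (a x) m vac = 0"
  using affine_commutator[of ch m ch n v] affine_commutator[of ch m ce n v]
    affine_commutator[of ch m cf n v] affine_commutator[of ce m ch n v]
    affine_commutator[of cf m ch n v] affine_commutator[of ce m ce n v]
    affine_commutator[of cf m cf n v] affine_commutator[of ce m cf n v]
    affine_commutator[of cf m ce n v]
  by (simp_all add: algebra_simps creation_nonneg split: if_splits)

lemma omega_in_N: "\<omega> \<in> N"
  unfolding heisenberg_commutant_def
proof (intro CollectI allI impI)
  fix m :: int assume "m \<ge> 0"
  \<comment> \<open>Contractions for small \<open>m\<close> need the actual numeral; beyond the
    weight 2, all contracted modes are annihilation modes.\<close>
  then consider "m = 0" | "m = 1" | "m = 2" | "m \<ge> 3" by force
  then show "h m \<omega> = 0"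
    by (intro eqI_functional, cases)
      (simp_all add: parafermion_omega_def Let_def word_rules algebra_simps)
qed

lemma W3_in_N: "W3 \<in> N"
  unfolding heisenberg_commutant_def
proof (intro CollectI allI impI)
  fix m :: int assume "m \<ge> 0"
  then consider "m = 0" | "m = 1" | "m = 2" | "m = 3" | "m \<ge> 4" by force
  then show "h m W3 = 0"
    by (intro eqI_functional, cases)
      (simp_all add: parafermion_W3_def Let_def word_rules algebra_simps power2_eq_square)
qed

section \<open>The weight grading\<close>

text \<open>The Sugawara conformal vector, with \<open>f(-1)e(-1)\<close> rewritten as
  \<open>e(-1)f(-1) - h(-2)\<close> on the vacuum.\<close>

definition sugawara :: 'v where
  "sugawara = scal V (1 / (4 * (k + 2))) (h (-1) (h (-1) vac)
     + scal V 4 (e (-1) (f (-1) vac)) - scal V 2 (h (-2) vac))"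

lemma sugawara_modes:
  "m \<ge> 0 \<Longrightarrow> nprod V (a x) m sugawara = (if m = 1 then a x else 0)"
proof -
  assume "m \<ge> 0"
  then consider "m = 0" | "m = 1" | "m = 2" | "m \<ge> 3" by force
  moreover have k2: "k + 2 \<noteq> 0" using level(4) by (simp add: add_eq_0_iff2)
  moreover have c: "\<phi> (a x) = \<phi> (nprod V (a x) (-1) vac)" for \<phi> :: "'v \<Rightarrow> complex" and x
    by (simp add: creation)
  ultimately show ?thesis
  proof cases
    case 1 then show ?thesis
      by (cases x; intro eqI_functional) (simp_all add: sugawara_def word_rules c algebra_simps)
  next
    case 2
    have "8 + k * 4 = 4 * (k + 2)" by simp
    then have "8 + k * 4 \<noteq> 0" using k2 by (simp del: distrib_left_numeral)
    moreover have "8 * y / (8 + k * 4) + k * (4 * y) / (8 + k * 4) = y * (8 + k * 4) / (8 + k * 4)" for y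
      unfolding add_divide_distrib[symmetric] by (simp add: algebra_simps)
    ultimately have d: "8 * y / (8 + k * 4) + k * (4 * y) / (8 + k * 4) = y" for y by simp
    from 2 show ?thesis
      by (cases x; intro eqI_functional) (simp_all add: sugawara_def word_rules c d algebra_simps)
  next
    case 3 then show ?thesis
      by (cases x; intro eqI_functional) (simp_all add: sugawara_def word_rules c field_simps k2)
  next
    case 4 then show ?thesis
      by (cases x; intro eqI_functional) (simp_all add: sugawara_def word_rules c field_simps k2)
  qed
qed

text \<open>By \<open>sugawara_modes\<close> only the index 1 survives in the commutator formula.
  Hence mode 1 of \<open>sugawara\<close> measures the degree of words.\<close>

lemma sugawara_commutator:
  "nprod V sugawara 1 (nprod V (a x) m v) = nprod V (a x) m (nprod V sugawara 1 v) - scal V (of_int m) (nprod V (a x) m v)"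
proof -
  have "nprod V (a x) m (nprod V sugawara 1 v) - nprod V sugawara 1 (nprod V (a x) m v) =
    (\<Sum>i<2. scal V (of_int m gchoose i) (nprod V (nprod V (a x) (int i) sugawara) (m + 1 - int i) v))"
    unfolding nprod_commutator by (rule Sum_any_eq_sum) (simp add: sugawara_modes)
  also have "\<dots> = scal V (of_int m) (nprod V (a x) m v)"
    by (simp add: sugawara_modes numeral_2_eq_2)
  finally show ?thesis by (simp add: algebra_simps)
qed

lemma sugawara_act: "nprod V sugawara 1 (act w vac) = scal V (of_int (word_degree w)) (act w vac)"
  by (induction w) (simp_all add: creation_nonneg sugawara_commutator flip: scale_left_diff_distrib)

lemma h_0_act: "h 0 (act w vac) = scal V (of_int (2 * word_charge w)) (act w vac)"
proof (induction w)
  case (Cons l w)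
  have "h 0 (nprod V (a x) m v) = nprod V (a x) m (h 0 v) + scal V (of_int (2 * sl2_charge x)) (nprod V (a x) m v)" for x m v
    using affine_commutator[of ch 0 x m v] by (cases x) (simp_all add: algebra_simps)
  then show ?case using Cons by (simp add: algebra_simps flip: scale_left_distrib)
qed (simp add: creation_nonneg)

text \<open>The two vectors differ by the conformal vector \<open>h(-1)^2/(4k)\<close> of the
  Heisenberg algebra. In its mode 1 every term has some \<open>h(i)\<close> with
  \<open>i \<ge> 0\<close> next to \<open>v\<close>.\<close>

lemma omega_1_eq_sugawara_1:
  assumes "v \<in> N"
  shows "nprod V \<omega> 1 v = nprod V sugawara 1 v"
proof -
  have k2: "k + 2 \<noteq> 0" using level(4) by (simp add: add_eq_0_iff2)
  have "\<omega> = sugawara - scal V (1 / (4 * k)) (h (-1) (h (-1) vac))"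
    by (rule eqI_functional)
      (use level(1) k2 in \<open>simp add: parafermion_omega_def Let_def sugawara_def divide_simps; algebra\<close>)
  moreover have "nprod V (h (-1) (h (-1) vac)) 1 v = 0"
  proof -
    obtain M where *: "nprod V (h (-1) (a ch)) 1 v = (\<Sum>i<M. scal V ((-1) ^ i * (of_int (-1) gchoose i))
       (h (-1 - int i) (h (1 + int i) v) - scal V ((-1) powi -1) (h (1 + -1 - int i) (h (int i) v))))"
      by (rule nprod_iterate_finite)
    show ?thesis using assms by (simp add: creation * heisenberg_commutant_def)
  qed
  ultimately show ?thesis by simp
qed

text \<open>In an expansion of \<open>v\<close> into words, those of degree other than
  \<open>d\<close> or of nonzero charge cancel, because \<open>v\<close> is an eigenvector of the
  weight operator and of \<open>h(0)\<close>. The remaining words are treated by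
  \<open>spanning_mod_H\<close>.\<close>

lemma weight_component:
  assumes "v \<in> N" "nprod V \<omega> 1 v = scal V (of_int d) v"
    and "functional \<phi>" "\<And>v. v \<in> H \<Longrightarrow> \<phi> v = 0"
    and ef: "\<And>us vs. \<forall>n\<in>set us \<union> set vs. n < 0 \<Longrightarrow> length us = length vs \<Longrightarrow>
          - sum_list us - sum_list vs = d \<Longrightarrow>
          \<phi> (act (map (Pair ce) us @ map (Pair cf) vs) vac) = 0"
  shows "\<phi> v = 0"
proof -
  have "v \<in> span (range (word_vector V a))" using span_words by simp
  then obtain t r where t: "finite t" "t \<subseteq> range (word_vector V a)" and v: "v = (\<Sum>u\<in>t. scal V (r u) u)"
    unfolding span_explicit by blast
  have "\<forall>u\<in>t. \<exists>w. u = act w vac" using t(2) by (auto simp: word_vector_eq_act)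
  then obtain W where W: "\<And>u. u \<in> t \<Longrightarrow> u = act (W u) vac" by metis
  \<comment> \<open>Degree and charge are integers, so the real and imaginary parts of the
    eigenvalues of this single operator record both.\<close>
  define D where "D u = nprod V sugawara 1 u + scal V \<i> (h 0 u)" for u
  define l :: "'v \<Rightarrow> complex" where "l u = of_int (word_degree (W u)) + \<i> * of_int (2 * word_charge (W u))" for u
  have D: "D (scal V (r u) u) = scal V (l u) (scal V (r u) u)" if "u \<in> t" for u
    using sugawara_act[of "W u"] h_0_act[of "W u"] W[OF that]
    by (simp add: D_def l_def distrib_left scale_left_distrib mult_ac)
  have "D v = scal V (of_int d) v"
    using assms(1,2) by (simp add: D_def omega_1_eq_sugawara_1 heisenberg_commutant_def)
  have linD: "Vector_Spaces.linear (scal V) (scal V) D"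
    by unfold_locales (simp_all add: D_def scale_right_distrib mult.commute)
  then interpret D: Vector_Spaces.linear "scal V" "scal V" D .
  define t1 where "t1 = {u\<in>t. l u = of_int d}"
  have D1: "D (\<Sum>u\<in>t1. scal V (r u) u) = scal V (of_int d) (\<Sum>u\<in>t1. scal V (r u) u)"
    unfolding D.sum scale_sum_right
    by (rule sum.cong) (auto simp: D t1_def)
  have s: "v = (\<Sum>u\<in>t1. scal V (r u) u) + (\<Sum>u\<in>t - t1. scal V (r u) u)"
    unfolding v using t(1) by (subst sum.subset_diff[of t1 t]) (auto simp: t1_def add.commute)
  have "(\<Sum>u\<in>t - t1. scal V (r u) u) = 0"
  proof (rule eigenvectors_sum_zero[OF _ vector_space_axioms linD])
    show "D (\<Sum>u\<in>t - t1. scal V (r u) u) = scal V (of_int d) (\<Sum>u\<in>t - t1. scal V (r u) u)"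
      using \<open>D v = scal V (of_int d) v\<close> D1 unfolding s
      by (simp add: D.add scale_right_distrib)
  qed (use t(1) D in \<open>auto simp: t1_def\<close>)
  then have "\<phi> v = (\<Sum>u\<in>t1. r u * \<phi> u)"
    using s assms(3) by simp
  also have "\<dots> = 0"
  proof (intro sum.neutral ballI)
    fix u assume u: "u \<in> t1"
    then have "l u = of_int d" by (simp add: t1_def)
    then have d: "word_degree (W u) = d" "word_charge (W u) = 0"
      by (auto simp: l_def complex_eq_iff)
    have "\<phi> (act (W u) vac) = 0"
      by (rule spanning_mod_H[OF assms(3,4) _ d]) (use ef in auto)
    then show "r u * \<phi> u = 0" using W u by (simp add: t1_def)
  qed
  finally show ?thesis .
qed


section \<open>Products modulo \<open>H\<close>\<close>

abbreviation ef where "ef \<equiv> e (-1) (f (-1) vac)"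
abbreviation e2f where "e2f \<equiv> e (-2) (f (-1) vac)"

text \<open>As \<open>n \<ge> - 1\<close>, the index \<open>n + i\<close> is at least
  \<open>M\<close> once \<open>i > M\<close>; so \<open>Suc M\<close> summands suffice.\<close>

lemma ef_mode:
  assumes "\<And>j. j \<ge> int M \<Longrightarrow> e j v = 0" "\<And>j. j \<ge> int M \<Longrightarrow> f j v = 0" "n \<ge> - 1"
  shows "nprod V ef n v = (\<Sum>i<Suc M. e (-1 - int i) (f (n + int i) v) + f (n - 1 - int i) (e (int i) v))"
proof -
  have "nprod V (e (-1) (a cf)) n v = (\<Sum>i<Suc M. e (-1 - int i) (f (n + int i) v) + f (n - 1 - int i) (e (int i) v))"
    unfolding nprod_iterate
    by (subst Sum_any_eq_sum[where N = "Suc M"])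
      (use assms in \<open>auto simp: gchoose_minus_1 intro!: sum.cong\<close>)
  then show ?thesis by (simp add: creation)
qed

lemma e2f_mode:
  assumes "\<And>j. j \<ge> int M \<Longrightarrow> e j v = 0" "\<And>j. j \<ge> int M \<Longrightarrow> f j v = 0" "n \<ge> - 1"
  shows "nprod V e2f n v = (\<Sum>i<Suc M. scal V (of_nat i + 1)
    (e (-2 - int i) (f (n + int i) v) - f (n - 2 - int i) (e (int i) v)))"
proof -
  have "nprod V (e (-2) (a cf)) n v = (\<Sum>i<Suc M. scal V (of_nat i + 1)
    (e (-2 - int i) (f (n + int i) v) - f (n - 2 - int i) (e (int i) v)))"
    unfolding nprod_iterate
    by (subst Sum_any_eq_sum[where N = "Suc M"])
      (use assms in \<open>auto simp: gchoose_minus_2 intro!: sum.cong\<close>)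
  then show ?thesis by (simp add: creation)
qed

text \<open>Clearing the denominator of \<open>\<omega>\<close> keeps all coefficients polynomial in
  \<open>k\<close>.\<close>

definition \<Omega> :: 'v where
  "\<Omega> = scal V (- k) (h (-2) vac) - h (-1) (h (-1) vac) + scal V (2 * k) ef"

lemma omega_eq_Omega: "\<omega> = scal V (1 / (2 * k * (k + 2))) \<Omega>"
  by (simp add: parafermion_omega_def \<Omega>_def Let_def)

text \<open>Trading \<open>e(-1)f(-2)\<close> for the derivative of \<open>ef\<close> leaves, apart
  from terms led by \<open>h\<close>, only \<open>e2f\<close> and \<open>T ef\<close>; the modes of
  the latter are given by \<open>nprod_translate\<close>.\<close>

lemma W3_eq: "W3 = scal V (k ^ 2) (h (-3) vac) + scal V (3 * k) (h (-2) (h (-1) vac))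
         + scal V 2 (h (-1) (h (-1) (h (-1) vac))) - scal V (6 * k) (h (-1) ef)
         + scal V (3 * k ^ 2) (scal V 2 e2f - T ef)"
proof -
  have "T ef = e2f + e (-1) (f (-2) vac)"
    unfolding T_nprod by (simp add: T_nprod)
  then show ?thesis
    by (intro eqI_functional) (simp add: parafermion_W3_def Let_def algebra_simps)
qed

text \<open>
  The vector \<open>E4\<close> is \<open>4k^3\<close> times the projection of \<open>e(-2)f(-2)\<one>\<close> onto \<open>N\<close> along \<open>H\<close>.
\<close>

definition E4 :: 'v where
  "E4 = h (-1) (h (-1) (h (-1) (h (-1) vac))) + scal V (2 * k) (h (-2) (h (-1) (h (-1) vac)))
      - scal V (k ^ 2) (h (-2) (h (-2) vac)) - scal V (2 * k ^ 3) (h (-4) vac)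
      - scal V (4 * k) (h (-1) (h (-1) ef)) + scal V (4 * k ^ 2) (h (-1) e2f)
      - scal V (4 * k ^ 2) (h (-1) (e (-1) (f (-2) vac))) + scal V (4 * k ^ 3) (e (-2) (f (-2) vac))"

lemma E4_in_N: "E4 \<in> N"
  unfolding heisenberg_commutant_def
proof (intro CollectI allI impI)
  fix m :: int assume "m \<ge> 0"
  then consider "m = 0" | "m = 1" | "m = 2" | "m = 3" | "m = 4" | "m \<ge> 5" by force
  then show "h m E4 = 0"
    by (intro eqI_functional, cases)
      (simp_all add: E4_def word_rules algebra_simps power2_eq_square power3_eq_cube)
qed

text \<open>These images have weight at most 0 and nonzero charge, whereas weight 0 contains only
  multiples of the vacuum.\<close>

lemma vanishing_modes:
  assumes "x = ce \<or> x = cf"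
  shows "j \<ge> 2 \<Longrightarrow> nprod V (a x) j \<Omega> = 0" "j \<ge> 3 \<Longrightarrow> nprod V (a x) j W3 = 0" "j \<ge> 4 \<Longrightarrow> nprod V (a x) j E4 = 0"
proof -
  show "nprod V (a x) j \<Omega> = 0" if j: "j \<ge> 2"
  proof -
    consider "j = 2" | "j \<ge> 3" using j by force
    then show ?thesis using assms by (intro eqI_functional, cases) (auto simp: \<Omega>_def word_rules algebra_simps)
  qed
  show "nprod V (a x) j W3 = 0" if j: "j \<ge> 3"
  proof -
    consider "j = 3" | "j \<ge> 4" using j by force
    then show ?thesis using assms by (intro eqI_functional, cases) (auto simp: parafermion_W3_def Let_def word_rules algebra_simps power2_eq_square)
  qed
  show "nprod V (a x) j E4 = 0" if j: "j \<ge> 4"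
  proof -
    consider "j = 4" | "j \<ge> 5" using j by force
    then show ?thesis using assms by (intro eqI_functional, cases) (auto simp: E4_def word_rules algebra_simps power2_eq_square power3_eq_cube)
  qed
qed

text \<open>The summands led by a creation mode of \<open>h\<close> act into \<open>H\<close> by
  \<open>h_iterate_in_H\<close>, so the functional does not see them.\<close>

lemma
  assumes "functional \<phi>" "\<forall>v\<in>H. \<phi> v = 0" "v \<in> N"
  shows Omega_mode: "\<phi> (nprod V \<Omega> n v) = 2 * k * \<phi> (nprod V ef n v)"
    and W3_mode: "\<phi> (nprod V W3 n v) = 3 * k ^ 2 * (2 * \<phi> (nprod V e2f n v) + of_int n * \<phi> (nprod V ef (n - 1) v))"
proof -
  have 1: "\<phi> (nprod V (h r w) n v) = 0" if "r < 0" for r w n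
    using h_iterate_in_H[OF assms(3) that] assms(2) by blast
  show "\<phi> (nprod V \<Omega> n v) = 2 * k * \<phi> (nprod V ef n v)"
    using assms(1) by (simp add: \<Omega>_def 1)
  show "\<phi> (nprod V W3 n v) = 3 * k ^ 2 * (2 * \<phi> (nprod V e2f n v) + of_int n * \<phi> (nprod V ef (n - 1) v))"
    using assms(1) nprod_translate[of ef n v] by (simp add: W3_eq 1 flip: T_def)
qed


text \<open>Terms led by \<open>h\<close> are kept here and in the next two tables: a further mode
  of \<open>e\<close> or \<open>f\<close> is applied before anything is reduced modulo
  \<open>H\<close>.\<close>

lemma Omega_action:
  "e 0 \<Omega> = - scal V (2 * k + 4) (e (-2) vac) + scal V (2 * k + 4) (h (-1) (e (-1) vac))"
  "e 1 \<Omega> = scal V (2 * k ^ 2 + 2 * k - 4) (e (-1) vac)"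
  "f (-1) \<Omega> = - scal V (2 * k + 4) (f (-3) vac) - scal V (3 * k) (h (-2) (f (-1) vac))
     - scal V 4 (h (-1) (f (-2) vac)) + scal V (2 * k) (e (-1) (f (-1) (f (-1) vac)))
     - h (-1) (h (-1) (f (-1) vac))"
  "f 0 \<Omega> = - scal V (2 * k + 4) (f (-2) vac) - scal V (2 * k + 4) (h (-1) (f (-1) vac))"
  "f 1 \<Omega> = scal V (2 * k ^ 2 + 2 * k - 4) (f (-1) vac)"
  by - (rule eqI_functional, simp add: \<Omega>_def word_rules algebra_simps power2_eq_square power3_eq_cube power4_eq_xxxx)+

lemma W3_action:
  "e 0 W3 = scal V (- 2 * k ^ 2 + 12 * k - 16) (e (-3) vac)
     - scal V (3 * k ^ 2 + 6 * k) (h (-2) (e (-1) vac))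
     + scal V (3 * k ^ 2 + 6 * k + 24) (h (-1) (e (-2) vac))
     + scal V (12 * k) (e (-1) (e (-1) (f (-1) vac))) - scal V (6 * k + 12) (h (-1) (h (-1) (e (-1) vac)))"
  "e 1 W3 = scal V (3 * k ^ 3 + 4 * k ^ 2 - 12 * k - 16) (e (-2) vac)
     + scal V (- 9 * k ^ 2 + 6 * k + 24) (h (-1) (e (-1) vac))"
  "e 2 W3 = scal V (- 6 * k ^ 3 + 10 * k ^ 2 + 12 * k - 16) (e (-1) vac)"
  "f (-1) W3 = scal V (2 * k ^ 2 + 12 * k + 16) (f (-4) vac)
     + scal V (- 2 * k ^ 2 + 12 * k) (h (-3) (f (-1) vac))
     + scal V (3 * k ^ 2 + 6 * k) (h (-2) (f (-2) vac)) + scal V (6 * k + 24) (h (-1) (f (-3) vac))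
     + scal V (3 * k ^ 2) (e (-2) (f (-1) (f (-1) vac)))
     - scal V (3 * k ^ 2 + 12 * k) (e (-1) (f (-2) (f (-1) vac)))
     + scal V (9 * k) (h (-2) (h (-1) (f (-1) vac))) + scal V 12 (h (-1) (h (-1) (f (-2) vac)))
     - scal V (6 * k) (h (-1) (e (-1) (f (-1) (f (-1) vac))))
     + scal V 2 (h (-1) (h (-1) (h (-1) (f (-1) vac))))"
  "f 0 W3 = scal V (2 * k ^ 2 + 12 * k + 16) (f (-3) vac)
     + scal V (- 3 * k ^ 2 + 18 * k) (h (-2) (f (-1) vac))
     + scal V (3 * k ^ 2 + 6 * k + 24) (h (-1) (f (-2) vac))
     - scal V (12 * k) (e (-1) (f (-1) (f (-1) vac))) + scal V (6 * k + 12) (h (-1) (h (-1) (f (-1) vac)))"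
  "f 1 W3 = scal V (- 3 * k ^ 3 - 4 * k ^ 2 + 12 * k + 16) (f (-2) vac)
     + scal V (- 9 * k ^ 2 + 6 * k + 24) (h (-1) (f (-1) vac))"
  "f 2 W3 = scal V (6 * k ^ 3 - 10 * k ^ 2 - 12 * k + 16) (f (-1) vac)"
  by - (rule eqI_functional, simp add: parafermion_W3_def Let_def word_rules algebra_simps power2_eq_square power3_eq_cube power4_eq_xxxx)+

lemma E4_action:
  "e 0 E4 = scal V (- 4 * k ^ 3 - 4 * k ^ 2 - 16 * k + 16) (e (-4) vac)
     + scal V (4 * k ^ 3 + 4 * k ^ 2 + 8 * k) (h (-2) (e (-2) vac))
     + scal V (16 * k - 32) (h (-1) (e (-3) vac))
     - scal V (8 * k ^ 2 + 16 * k) (e (-2) (e (-1) (f (-1) vac)))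
     + scal V (8 * k ^ 2) (e (-1) (e (-1) (f (-2) vac)))
     - scal V (4 * k ^ 2 + 8 * k) (h (-2) (h (-1) (e (-1) vac)))
     + scal V (4 * k ^ 2 + 4 * k + 24) (h (-1) (h (-1) (e (-2) vac)))
     + scal V (16 * k) (h (-1) (e (-1) (e (-1) (f (-1) vac))))
     - scal V (4 * k + 8) (h (-1) (h (-1) (h (-1) (e (-1) vac))))"
  "e 1 E4 = scal V (- 4 * k ^ 3 - 4 * k ^ 2 - 16 * k + 16) (e (-3) vac)
     + scal V (12 * k ^ 2 + 8 * k) (h (-2) (e (-1) vac))
     + scal V (8 * k ^ 3 - 16 * k - 32) (h (-1) (e (-2) vac))
     - scal V (16 * k) (e (-1) (e (-1) (f (-1) vac)))
     + scal V (- 8 * k ^ 2 + 12 * k + 24) (h (-1) (h (-1) (e (-1) vac)))"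
  "e 2 E4 = scal V (8 * k ^ 4 - 4 * k ^ 3 - 20 * k ^ 2 + 16 * k + 16) (e (-2) vac)
     + scal V (- 8 * k ^ 3 + 24 * k ^ 2 - 32) (h (-1) (e (-1) vac))"
  "e 3 E4 = scal V (20 * k ^ 3 - 20 * k ^ 2 - 16 * k + 16) (e (-1) vac)"
  "f 0 E4 = scal V (- 4 * k ^ 3 - 4 * k ^ 2 + 16 * k + 16) (f (-4) vac)
     + scal V (- 8 * k ^ 2 + 16 * k) (h (-3) (f (-1) vac))
     + scal V (- 4 * k ^ 3 + 4 * k ^ 2 + 8 * k) (h (-2) (f (-2) vac))
     + scal V (16 * k + 32) (h (-1) (f (-3) vac)) + scal V (8 * k ^ 2) (e (-2) (f (-1) (f (-1) vac)))
     - scal V (8 * k ^ 2 + 16 * k) (e (-1) (f (-2) (f (-1) vac)))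
     + scal V (- 4 * k ^ 2 + 24 * k) (h (-2) (h (-1) (f (-1) vac)))
     + scal V (4 * k ^ 2 + 4 * k + 24) (h (-1) (h (-1) (f (-2) vac)))
     - scal V (16 * k) (h (-1) (e (-1) (f (-1) (f (-1) vac))))
     + scal V (4 * k + 8) (h (-1) (h (-1) (h (-1) (f (-1) vac))))"
  "f 1 E4 = scal V (- 4 * k ^ 3 - 4 * k ^ 2 + 16 * k + 16) (f (-3) vac)
     + scal V (- 12 * k ^ 2 + 24 * k) (h (-2) (f (-1) vac))
     + scal V (- 8 * k ^ 3 + 16 * k + 32) (h (-1) (f (-2) vac))
     - scal V (16 * k) (e (-1) (f (-1) (f (-1) vac)))
     + scal V (- 8 * k ^ 2 + 12 * k + 24) (h (-1) (h (-1) (f (-1) vac)))"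
  "f 2 E4 = scal V (8 * k ^ 4 - 4 * k ^ 3 - 20 * k ^ 2 + 16 * k + 16) (f (-2) vac)
     + scal V (8 * k ^ 3 - 24 * k ^ 2 + 32) (h (-1) (f (-1) vac))"
  "f 3 E4 = scal V (20 * k ^ 3 - 20 * k ^ 2 - 16 * k + 16) (f (-1) vac)"
  by - (rule eqI_functional, simp add: E4_def word_rules algebra_simps power2_eq_square power3_eq_cube power4_eq_xxxx)+


lemma Omega_in_N: "\<Omega> \<in> N"
proof -
  have "2 * k * (k + 2) \<noteq> 0" using level by (simp add: add_eq_0_iff2)
  then have "\<Omega> = scal V (2 * k * (k + 2)) \<omega>" by (simp add: omega_eq_Omega)
  then show ?thesis using omega_in_N subspace_scale[OF subspace_N] by simp
qed

text \<open>Here and in the four expansions that follow, the cut-off is the weight of the vector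
  acted on, as provided by \<open>vanishing_modes\<close>.\<close>

lemma ef_Omega:
  "n \<ge> - 1 \<Longrightarrow> nprod V ef n \<Omega> = e (-1) (f n \<Omega>) + e (-2) (f (n + 1) \<Omega>) + e (-3) (f (n + 2) \<Omega>)
     + f (n - 1) (e 0 \<Omega>) + f (n - 2) (e 1 \<Omega>)"
  by (subst ef_mode[of 2]) (simp_all add: vanishing_modes numeral_2_eq_2 algebra_simps)

lemma ef_W3:
  "n \<ge> - 1 \<Longrightarrow> nprod V ef n W3 = e (-1) (f n W3) + e (-2) (f (n + 1) W3) + e (-3) (f (n + 2) W3)
     + e (-4) (f (n + 3) W3) + f (n - 1) (e 0 W3) + f (n - 2) (e 1 W3) + f (n - 3) (e 2 W3)"
  by (subst ef_mode[of 3]) (simp_all add: vanishing_modes numeral_3_eq_3 algebra_simps)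

lemma e2f_W3:
  "n \<ge> - 1 \<Longrightarrow> nprod V e2f n W3 = e (-2) (f n W3) + scal V 2 (e (-3) (f (n + 1) W3))
     + scal V 3 (e (-4) (f (n + 2) W3)) + scal V 4 (e (-5) (f (n + 3) W3))
     - f (n - 2) (e 0 W3) - scal V 2 (f (n - 3) (e 1 W3)) - scal V 3 (f (n - 4) (e 2 W3))"
  by (rule eqI_functional, subst e2f_mode[of 3]) (simp_all add: vanishing_modes numeral_3_eq_3 algebra_simps)

lemma ef_E4:
  "n \<ge> 0 \<Longrightarrow> nprod V ef n E4 = e (-1) (f n E4) + e (-2) (f (n + 1) E4) + e (-3) (f (n + 2) E4)
     + e (-4) (f (n + 3) E4) + f (n - 1) (e 0 E4) + f (n - 2) (e 1 E4) + f (n - 3) (e 2 E4) + f (n - 4) (e 3 E4)"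
  by (subst ef_mode[of 4]) (simp_all add: vanishing_modes eval_nat_numeral algebra_simps)

lemma e2f_E4:
  "n \<ge> 0 \<Longrightarrow> nprod V e2f n E4 = e (-2) (f n E4) + scal V 2 (e (-3) (f (n + 1) E4))
     + scal V 3 (e (-4) (f (n + 2) E4)) + scal V 4 (e (-5) (f (n + 3) E4))
     - f (n - 2) (e 0 E4) - scal V 2 (f (n - 3) (e 1 E4)) - scal V 3 (f (n - 4) (e 2 E4)) - scal V 4 (f (n - 5) (e 3 E4))"
  by (rule eqI_functional, subst e2f_mode[of 4]) (simp_all add: vanishing_modes eval_nat_numeral algebra_simps)

section \<open>Products evaluated by a functional that vanishes on \<open>H\<close>\<close>

context
  fixes \<phi> :: "'v \<Rightarrow> complex"
  assumes \<phi>: "functional \<phi>" "\<forall>v\<in>H. \<phi> v = 0"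
begin

private lemma hk: "n < 0 \<Longrightarrow> \<phi> (h n v) = 0"
  using \<phi>(2) h_in_H by blast

private lemmas modes = Omega_mode[OF \<phi> Omega_in_N] Omega_mode[OF \<phi> W3_in_N]
  W3_mode[OF \<phi> W3_in_N] W3_mode[OF \<phi> E4_in_N]
private lemmas act = ef_Omega ef_W3 e2f_W3 ef_E4 e2f_E4 vanishing_modes Omega_action W3_action E4_action
private lemmas calc = word_rules hk \<phi>(1) algebra_simps power2_eq_square power3_eq_cube power4_eq_xxxx

lemma Omega_Omega:
  "\<phi> (nprod V \<Omega> 3 \<Omega>) = 4 * k ^ 2 * (k - 1) * (k + 2) * \<phi> vac"
  "\<phi> (nprod V \<Omega> 2 \<Omega>) = 0"
  "\<phi> (nprod V \<Omega> (-1) \<Omega>) = 4 * k ^ 2 * ((k + 6) * \<phi> (e (-3) (f (-1) vac)) - 2 * \<phi> (e (-2) (f (-2) vac))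
     + (k + 2) * \<phi> (e (-1) (f (-3) vac)) + \<phi> (e (-1) (e (-1) (f (-1) (f (-1) vac)))))"
  by (simp_all add: modes act calc)

lemma Omega_W3:
  "\<phi> (nprod V \<Omega> 2 W3) = 0"
  "\<phi> (nprod V \<Omega> (-1) W3) = 6 * k ^ 3 * ((2 * k + 6) * \<phi> (e (-4) (f (-1) vac))
     - (k + 6) * \<phi> (e (-3) (f (-2) vac)) + (k + 4) * \<phi> (e (-2) (f (-3) vac)) - (2 * k + 4) * \<phi> (e (-1) (f (-4) vac))
     + \<phi> (e (-2) (e (-1) (f (-1) (f (-1) vac)))) - \<phi> (e (-1) (e (-1) (f (-2) (f (-1) vac)))))"
  by (simp_all add: modes act calc)

lemma W3_W3:
  "\<phi> (nprod V W3 3 W3) = 36 * k ^ 3 * (k - 2) * (3 * k + 4) * \<phi> ef"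
  "\<phi> (nprod V W3 1 W3) = 18 * k ^ 3 * ((5 * k ^ 2 + 2 * k - 24) * \<phi> (e (-3) (f (-1) vac))
     + (8 - 6 * k - 3 * k ^ 2) * \<phi> (e (-2) (f (-2) vac))
     + (5 * k ^ 2 + 2 * k - 8) * \<phi> (e (-1) (f (-3) vac)) - 4 * \<phi> (e (-1) (e (-1) (f (-1) (f (-1) vac)))))"
  by (simp_all add: modes act calc)

lemma W3_E4:
  "\<phi> (nprod V W3 1 E4) = 24 * k ^ 4 * ((8 * k + 12) * \<phi> (e (-4) (f (-1) vac))
     + (5 * k ^ 2 + 6 * k - 12) * (\<phi> (e (-3) (f (-2) vac)) - \<phi> (e (-2) (f (-3) vac)))
     - 4 * \<phi> (e (-2) (f (-3) vac)) - (8 * k + 8) * \<phi> (e (-1) (f (-4) vac))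
     + 2 * \<phi> (e (-2) (e (-1) (f (-1) (f (-1) vac)))) - 2 * \<phi> (e (-1) (e (-1) (f (-2) (f (-1) vac)))))"
  by (simp_all add: modes act calc)

end


section \<open>Subalgebras containing \<open>W3\<close>\<close>

text \<open>Separation by functionals puts \<open>v\<close> into \<open>U + H\<close>. Its component
  in \<open>H\<close> also lies in \<open>N\<close>, hence is 0 by \<open>N_Int_H\<close>.\<close>

lemma mem_subspace_of_N:
  assumes "subspace U" "U \<subseteq> N" "v \<in> N"
    and "\<And>\<phi>. functional \<phi> \<Longrightarrow> \<forall>x\<in>H. \<phi> x = 0 \<Longrightarrow> \<forall>u\<in>U. \<phi> u = 0 \<Longrightarrow> \<phi> v = 0"
  shows "v \<in> U"
proof -
  have "v \<in> span (U \<union> H)"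
  proof (rule ccontr)
    assume "v \<notin> span (U \<union> H)"
    then obtain \<phi> where "functional \<phi>" "\<And>x. x \<in> span (U \<union> H) \<Longrightarrow> \<phi> x = 0" "\<phi> v \<noteq> 0"
      by (rule separating_functional[OF subspace_span]) blast
    then show False using assms(4)[of \<phi>] by (auto intro: span_base)
  qed
  then obtain u x where v: "v = u + x" "u \<in> U" "x \<in> H"
    using assms(1) subspace_H by (auto simp: span_Un span_eq_iff[THEN iffD2])
  then have "x \<in> N"
    using subspace_diff[OF subspace_N assms(3), of u] assms(2) by auto
  then show ?thesis using v N_Int_H[of x] by simp
qed

lemma eq_in_N:
  assumes "v \<in> N" "w \<in> N" "\<And>\<phi>. functional \<phi> \<Longrightarrow> \<forall>x\<in>H. \<phi> x = 0 \<Longrightarrow> \<phi> v = \<phi> w"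
  shows "v = w"
proof -
  have "v - w \<in> {0}"
    by (rule mem_subspace_of_N)
      (use assms subspace_0[OF subspace_N] subspace_diff[OF subspace_N] in \<open>auto simp: subspace_single_0\<close>)
  then show ?thesis by simp
qed

lemma T_ef: "T (e m (f n v)) = e m (f n (T v)) - scal V (of_int n) (e m (f (n - 1) v)) - scal V (of_int m) (e (m - 1) (f n v))"
  by (simp add: T_nprod)

lemma Omega_eq: "\<Omega> = scal V (2 * k * (k + 2)) \<omega>"
proof -
  have "2 * k * (k + 2) \<noteq> 0" using level by (simp add: add_eq_0_iff2)
  then show ?thesis by (simp add: omega_eq_Omega)
qed

lemma functional_Omega: "functional \<phi> \<Longrightarrow> \<forall>x\<in>H. \<phi> x = 0 \<Longrightarrow> \<phi> \<Omega> = 2 * k * \<phi> ef"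
  using h_in_H by (simp add: \<Omega>_def)

lemma functional_W3: "functional \<phi> \<Longrightarrow> \<forall>x\<in>H. \<phi> x = 0 \<Longrightarrow> \<phi> W3 = 3 * k ^ 2 * (\<phi> e2f - \<phi> (e (-1) (f (-2) vac)))"
  using h_in_H by (simp add: parafermion_W3_def Let_def algebra_simps)

text \<open>Both sides lie in \<open>N\<close> and are compared modulo \<open>H\<close>, where
  \<open>\<Omega>\<close> becomes \<open>2k\<close> times \<open>ef\<close>.\<close>

lemma W3_3_W3: "nprod V W3 3 W3 = scal V (18 * k ^ 2 * (k - 2) * (3 * k + 4)) \<Omega>"
proof (rule eq_in_N)
  fix \<phi> assume \<phi>: "functional \<phi>" "\<forall>x\<in>H. \<phi> x = 0"
  show "\<phi> (nprod V W3 3 W3) = \<phi> (scal V (18 * k ^ 2 * (k - 2) * (3 * k + 4)) \<Omega>)"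
    using \<phi>(1) by (simp add: W3_W3[OF \<phi>] functional_Omega[OF \<phi>] power2_eq_square power3_eq_cube)
qed (simp_all add: N_nprod W3_in_N Omega_in_N subspace_scale[OF subspace_N])

lemma W3_3_W3_coeff: "18 * k ^ 2 * (k - 2) * (3 * k + 4) \<noteq> 0"
  using level by auto

lemma vac_in_N: "vac \<in> N"
  by (simp add: heisenberg_commutant_def creation_nonneg)

lemma Omega_3_Omega: "nprod V \<Omega> 3 \<Omega> = scal V (4 * k ^ 2 * (k - 1) * (k + 2)) vac"
  by (rule eq_in_N)
    (simp_all add: N_nprod Omega_in_N Omega_Omega subspace_scale[OF subspace_N] vac_in_N)

lemma Omega_2_Omega: "nprod V \<Omega> 2 \<Omega> = 0"
  by (rule eq_in_N) (simp_all add: N_nprod Omega_in_N Omega_Omega subspace_0[OF subspace_N])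

lemma omega_2_W3: "nprod V \<omega> 2 W3 = 0"
proof -
  have "nprod V \<Omega> 2 W3 = 0"
    by (rule eq_in_N) (simp_all add: N_nprod Omega_in_N W3_in_N Omega_W3 subspace_0[OF subspace_N])
  then show ?thesis by (simp add: omega_eq_Omega)
qed

text \<open>Its product \<open>\<Omega>_3 \<Omega>\<close>, which carries the central charge, is a
  nonzero multiple of the vacuum.\<close>

lemma Omega_nonzero: "\<Omega> \<noteq> 0"
proof
  assume "\<Omega> = 0"
  then have "scal V (4 * k ^ 2 * (k - 1) * (k + 2)) vac = 0" using Omega_3_Omega by simp
  then show False using level vacuum_nonzero by (auto simp: add_eq_0_iff2)
qed

lemma omega_1_Omega: "nprod V \<omega> 1 \<Omega> = scal V 2 \<Omega>"
  unfolding omega_1_eq_sugawara_1[OF Omega_in_N]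
  by (rule eqI_functional)
    (simp add: \<Omega>_def sugawara_commutator creation_nonneg algebra_simps)

lemma omega_1_W3: "nprod V \<omega> 1 W3 = scal V 3 W3"
  unfolding omega_1_eq_sugawara_1[OF W3_in_N]
  by (rule eqI_functional)
    (simp add: parafermion_W3_def Let_def sugawara_commutator creation_nonneg algebra_simps)

text \<open>Unlike \<open>W3\<close>, the vector \<open>T \<Omega>\<close> is not killed by \<open>\<omega>_2\<close>.\<close>

lemma primary_weight_3:
  assumes "v \<in> N" "nprod V \<omega> 1 v = scal V 3 v" "nprod V \<omega> 2 v = 0"
  shows "\<exists>c. v = scal V c W3"
proof -
  have TN: "T \<Omega> \<in> N"
    unfolding T_def by (intro N_nprod Omega_in_N vac_in_N)
  have "v \<in> span {W3, T \<Omega>}"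
  proof (rule mem_subspace_of_N[OF subspace_span _ assms(1)])
    show "span {W3, T \<Omega>} \<subseteq> N"
      by (rule span_minimal) (use W3_in_N TN subspace_N in auto)
    fix \<phi> assume \<phi>: "functional \<phi>" "\<forall>x\<in>H. \<phi> x = 0" "\<forall>u\<in>span {W3, T \<Omega>}. \<phi> u = 0"
    \<comment> \<open>\<open>W3\<close> yields the difference and \<open>T \<Omega>\<close> the sum
      of the two charge-zero words of degree 3 in \<open>e\<close> and \<open>f\<close>, so both are
      killed.\<close>
    have "\<phi> W3 = 0" "\<phi> (T \<Omega>) = 0" using \<phi>(3) by (auto intro: span_base)
    moreover have "\<phi> (T \<Omega>) = 2 * k * \<phi> (T ef)"
      using functional_Omega[OF functional_comp_T[OF \<phi>(1)]] T_in_H \<phi>(2) by blast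
    ultimately have "\<phi> e2f = \<phi> (e (-1) (f (-2) vac))" "\<phi> e2f + \<phi> (e (-1) (f (-2) vac)) = 0"
      using level(1) functional_W3[OF \<phi>(1,2)] by (auto simp: T_ef \<phi>(1) add.commute)
    then have z: "\<phi> e2f = 0" "\<phi> (e (-1) (f (-2) vac)) = 0" by auto
    show "\<phi> v = 0"
    proof (rule weight_component[of v 3])
      fix us vs :: "int list"
      assume "\<forall>n\<in>set us \<union> set vs. n < 0" "length us = length vs" "- sum_list us - sum_list vs = 3"
      then show "\<phi> (act (map (Pair ce) us @ map (Pair cf) vs) vac) = 0"
        by (rule negative_lists_cases) (use z negative_pair(2) in \<open>force+\<close>)
    qed (use assms \<phi> in auto)
  qed
  then obtain c d where v: "v = scal V c W3 + scal V d (T \<Omega>)"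
    by (auto simp: span_insert span_singleton algebra_simps)
  have "nprod V \<omega> 2 (T \<Omega>) = T (nprod V \<omega> 2 \<Omega>) + scal V 2 (nprod V \<omega> 1 \<Omega>)"
    using T_nprod[of \<omega> 2 \<Omega>] by (simp add: algebra_simps)
  also have "\<dots> = scal V 4 \<Omega>"
  proof -
    have "nprod V \<omega> 2 \<Omega> = 0" by (simp add: omega_eq_Omega Omega_2_Omega)
    then show ?thesis by (simp add: omega_1_Omega)
  qed
  finally have "scal V (d * 4) \<Omega> = 0"
    using assms(3) by (simp add: v omega_2_W3)
  then have "d = 0" using Omega_nonzero by simp
  then show ?thesis using v by auto
qed

section \<open>Words of weight 2 to 5 reached from \<open>W3\<close>\<close>

context
  fixes U
  assumes U: "vertex_subalgebra V U" "U \<subseteq> N" "W3 \<in> U"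
begin

private definition annih :: "('v \<Rightarrow> complex) \<Rightarrow> bool" where
  "annih \<phi> \<longleftrightarrow> functional \<phi> \<and> (\<forall>x\<in>H. \<phi> x = 0) \<and> (\<forall>u\<in>U. \<phi> u = 0)"

private lemma U_nprod: "u \<in> U \<Longrightarrow> v \<in> U \<Longrightarrow> nprod V u n v \<in> U"
  using U(1) by (simp add: vertex_subalgebra_def)

text \<open>\<open>U\<close> and \<open>H\<close> are stable under \<open>T\<close>, so every
  relation in one weight yields its derivative in the next.\<close>

private lemma annih_T: "annih \<phi> \<Longrightarrow> annih (\<lambda>v. \<phi> (T v))"
  using functional_comp_T T_in_H U_nprod U(1) by (auto simp: annih_def T_def vertex_subalgebra_def)

private lemma Omega_in_U: "\<Omega> \<in> U"
proof -
  have "\<Omega> = scal V (1 / (18 * k ^ 2 * (k - 2) * (3 * k + 4))) (nprod V W3 3 W3)"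
    using W3_3_W3_coeff by (simp add: W3_3_W3)
  then show ?thesis
    using U_nprod[OF U(3) U(3)] U(1) subspace_scale by (metis vertex_subalgebra_def)
qed

private lemma annih_2: "annih \<phi> \<Longrightarrow> \<phi> ef = 0"
  using Omega_in_U functional_Omega level(1) by (fastforce simp: annih_def)

private lemma annih_3:
  assumes "annih \<phi>"
  shows "\<phi> e2f = 0" "\<phi> (e (-1) (f (-2) vac)) = 0"
proof -
  have \<phi>: "functional \<phi>" "\<forall>x\<in>H. \<phi> x = 0" "\<phi> W3 = 0"
    using assms U(3) by (auto simp: annih_def)
  have "\<phi> e2f = \<phi> (e (-1) (f (-2) vac))"
    using functional_W3[OF \<phi>(1,2)] \<phi>(3) level(1) by auto
  moreover have "\<phi> e2f + \<phi> (e (-1) (f (-2) vac)) = 0"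
    using annih_2[OF annih_T[OF assms]] \<phi>(1) by (simp add: T_ef add.commute)
  ultimately show "\<phi> e2f = 0" "\<phi> (e (-1) (f (-2) vac)) = 0" by auto
qed

text \<open>
  Derivatives of the lower weights leave two unknowns in weight 4, and also in weight 5.  They
  are killed by \<open>\<Omega>_(-1) \<Omega>\<close> and \<open>W3_1 W3\<close>, respectively by \<open>\<Omega>_(-1) W3\<close> and \<open>W3_1 E4\<close>.
\<close>

private lemma annih_4:
  assumes "annih \<phi>"
  shows "\<phi> (e (-3) (f (-1) vac)) = 0" "\<phi> (e (-2) (f (-2) vac)) = 0" "\<phi> (e (-1) (f (-3) vac)) = 0"
    "\<phi> (e (-1) (e (-1) (f (-1) (f (-1) vac)))) = 0"
proof -
  have \<phi>: "functional \<phi>" "\<forall>x\<in>H. \<phi> x = 0" using assms by (auto simp: annih_def)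
  define x1 x2 x3 y where "x1 = \<phi> (e (-3) (f (-1) vac))" and "x2 = \<phi> (e (-2) (f (-2) vac))"
    and "x3 = \<phi> (e (-1) (f (-3) vac))" and "y = \<phi> (e (-1) (e (-1) (f (-1) (f (-1) vac))))"
  note defs = x1_def x2_def x3_def y_def
  \<comment> \<open>Derivatives of the two relations of weight 3.\<close>
  have "2 * x1 + x2 = 0" "x2 + 2 * x3 = 0"
    using annih_3[OF annih_T[OF assms]] \<phi>(1) by (simp_all add: T_ef defs add.commute)
  then have x: "x2 = - 2 * x1" "x3 = x1" by (simp_all add: add_eq_0_iff2)
  have "\<phi> (nprod V \<Omega> (-1) \<Omega>) = 0" "\<phi> (nprod V W3 1 W3) = 0"
    using assms U_nprod Omega_in_U U(3) by (auto simp: annih_def)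
  then have "(k + 6) * x1 - 2 * x2 + (k + 2) * x3 + y = 0"
    "(5 * k ^ 2 + 2 * k - 24) * x1 + (8 - 6 * k - 3 * k ^ 2) * x2 + (5 * k ^ 2 + 2 * k - 8) * x3 - 4 * y = 0"
    unfolding Omega_Omega(3)[OF \<phi>] W3_W3(2)[OF \<phi>] defs[symmetric] using level(1) by simp_all
  \<comment> \<open>The first product determines \<open>y\<close>; substituting it into the second
    leaves \<open>8k(2k+3)\<close> as the coefficient of \<open>x1\<close>.\<close>
  then have "y = - (2 * k + 12) * x1" "8 * k * (2 * k + 3) * x1 = 0"
    unfolding x by algebra+
  then have "x1 = 0" "y = 0" using level by auto
  then show "\<phi> (e (-3) (f (-1) vac)) = 0" "\<phi> (e (-2) (f (-2) vac)) = 0" "\<phi> (e (-1) (f (-3) vac)) = 0"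
    "\<phi> (e (-1) (e (-1) (f (-1) (f (-1) vac)))) = 0"
    using x by (simp_all add: defs)
qed

text \<open>Modulo \<open>H\<close> the vector \<open>E4\<close> is a multiple of
  \<open>e(-2)f(-2)\<close> on the vacuum, which \<open>annih_4\<close> covers. It is the explicit
  vector of weight 4 needed for the product in weight 5.\<close>

private lemma E4_in_U: "E4 \<in> U"
proof (rule mem_subspace_of_N[OF _ U(2) E4_in_N])
  fix \<phi> assume \<phi>: "functional \<phi>" "\<forall>x\<in>H. \<phi> x = 0" "\<forall>u\<in>U. \<phi> u = 0"
  then have "\<phi> (e (-2) (f (-2) vac)) = 0" using annih_4 by (simp add: annih_def)
  then show "\<phi> E4 = 0" using \<phi> h_in_H by (simp add: E4_def)
qed (use U(1) in \<open>simp add: vertex_subalgebra_def\<close>)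

private lemma annih_5:
  assumes "annih \<phi>"
  shows "\<phi> (e (-4) (f (-1) vac)) = 0" "\<phi> (e (-3) (f (-2) vac)) = 0" "\<phi> (e (-2) (f (-3) vac)) = 0"
    "\<phi> (e (-1) (f (-4) vac)) = 0" "\<phi> (e (-2) (e (-1) (f (-1) (f (-1) vac)))) = 0"
    "\<phi> (e (-1) (e (-1) (f (-2) (f (-1) vac)))) = 0"
proof -
  have \<phi>: "functional \<phi>" "\<forall>x\<in>H. \<phi> x = 0" using assms by (auto simp: annih_def)
  define x1 x2 x3 x4 y1 y2 where "x1 = \<phi> (e (-4) (f (-1) vac))" and "x2 = \<phi> (e (-3) (f (-2) vac))"
    and "x3 = \<phi> (e (-2) (f (-3) vac))" and "x4 = \<phi> (e (-1) (f (-4) vac))"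
    and "y1 = \<phi> (e (-2) (e (-1) (f (-1) (f (-1) vac))))"
    and "y2 = \<phi> (e (-1) (e (-1) (f (-2) (f (-1) vac))))"
  note defs = x1_def x2_def x3_def x4_def y1_def y2_def
  \<comment> \<open>Derivatives of the four relations of weight 4 reduce the six unknowns to
    \<open>x1\<close> and \<open>y1\<close>.\<close>
  have "3 * x1 + x2 = 0" "2 * x2 + 2 * x3 = 0" "x3 + 3 * x4 = 0" "2 * y1 + 2 * y2 = 0"
    using annih_4[OF annih_T[OF assms]] \<phi>(1) by (simp_all add: T_nprod word_rules defs add.commute)
  then have x: "x2 = - 3 * x1" "x3 = 3 * x1" "x4 = - x1" "y2 = - y1" by algebra+
  have "\<phi> (nprod V \<Omega> (-1) W3) = 0" "\<phi> (nprod V W3 1 E4) = 0"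
    using assms U_nprod Omega_in_U E4_in_U U(3) by (auto simp: annih_def)
  then have "(2 * k + 6) * x1 - (k + 6) * x2 + (k + 4) * x3 - (2 * k + 4) * x4 + y1 - y2 = 0"
    "(8 * k + 12) * x1 + (5 * k ^ 2 + 6 * k - 12) * (x2 - x3) - 4 * x3 - (8 * k + 8) * x4 + 2 * y1 - 2 * y2 = 0"
    unfolding Omega_W3(2)[OF \<phi>] W3_E4[OF \<phi>] defs[symmetric] using level(1) by simp_all
  then have "y1 = - (5 * k + 20) * x1" "10 * k * (3 * k + 4) * x1 = 0"
    unfolding x by algebra+
  then have "x1 = 0" "y1 = 0" using level by auto
  then show "\<phi> (e (-4) (f (-1) vac)) = 0" "\<phi> (e (-3) (f (-2) vac)) = 0" "\<phi> (e (-2) (f (-3) vac)) = 0"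
    "\<phi> (e (-1) (f (-4) vac)) = 0" "\<phi> (e (-2) (e (-1) (f (-1) (f (-1) vac)))) = 0"
    "\<phi> (e (-1) (e (-1) (f (-2) (f (-1) vac)))) = 0"
    using x by (simp_all add: defs)
qed

lemma omega_in_subalgebra: "\<omega> \<in> U"
  using Omega_in_U U(1) subspace_scale unfolding omega_eq_Omega vertex_subalgebra_def by blast

text \<open>By \<open>weight_component\<close> only charge-zero words in \<open>e\<close> and
  \<open>f\<close> of degree 4 or 5 matter, and a functional that kills \<open>U\<close> and
  \<open>H\<close> kills all of these.\<close>

lemma low_weight_in_subalgebra:
  assumes "v \<in> N" "nprod V \<omega> 1 v = scal V (of_int d) v" "d = 4 \<or> d = 5"
  shows "v \<in> U"
proof (rule mem_subspace_of_N[OF _ U(2) assms(1)])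
  fix \<phi> assume \<phi>: "functional \<phi>" "\<forall>x\<in>H. \<phi> x = 0" "\<forall>u\<in>U. \<phi> u = 0"
  then have "annih \<phi>" by (simp add: annih_def)
  note z = annih_4[OF this] annih_5[OF this]
  \<comment> \<open>The enumeration produces both orders of two creation modes of the same letter,
    while \<open>annih_5\<close> speaks of one.\<close>
  have c: "e (-1) (e (-2) v) = e (-2) (e (-1) v)" "f (-1) (f (-2) v) = f (-2) (f (-1) v)" for v
    by (simp_all add: word_rules)
  show "\<phi> v = 0"
  proof (rule weight_component[OF assms(1,2) \<phi>(1)])
    fix us vs :: "int list"
    assume w: "\<forall>n\<in>set us \<union> set vs. n < 0" "length us = length vs" "- sum_list us - sum_list vs = d"
    show "\<phi> (act (map (Pair ce) us @ map (Pair cf) vs) vac) = 0"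
      using w
    proof (rule negative_lists_cases)
      show "0 < d" "d \<le> 5" using assms(3) by auto
    next
      fix m n assume *: "us = [m]" "vs = [n]" "m < 0" "n < 0" "m + n = - d"
      show ?thesis
        using assms(3) negative_pair(3,4)[OF *(3,4)] *(5) by (auto simp: * z)
    next
      fix p q m n assume *: "us = [p, q]" "vs = [m, n]" "p < 0" "q < 0" "m < 0" "n < 0" "p + q + m + n = - d"
      show ?thesis
        using assms(3) negative_quadruple[OF *(3-6)] *(7) by (auto simp: * z c)
    qed
  qed (use \<phi> in auto)
qed (use U(1) in \<open>simp add: vertex_subalgebra_def\<close>)

end

end

section \<open>Generation and automorphisms\<close>

context vertex_algebra
begin

lemma vertex_subalgebra_Inter:
  "(\<And>U. U \<in> \<U> \<Longrightarrow> vertex_subalgebra V U) \<Longrightarrow> vertex_subalgebra V (\<Inter>\<U>)"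
  unfolding vertex_subalgebra_def by (auto intro!: subspace_Inter)

lemma
  assumes "vertex_subalgebra V A" "S \<subseteq> A"
  shows vertex_subalgebra_generated: "vertex_subalgebra V (generated_subalgebra V A S)"
    and generated_subset: "generated_subalgebra V A S \<subseteq> A"
    and generators_subset: "S \<subseteq> generated_subalgebra V A S"
  unfolding generated_subalgebra_def hull_def
  using assms by (auto intro!: vertex_subalgebra_Inter)

lemma generated_minimal:
  "vertex_subalgebra V U \<Longrightarrow> U \<subseteq> A \<Longrightarrow> S \<subseteq> U \<Longrightarrow> generated_subalgebra V A S \<subseteq> U"
  unfolding generated_subalgebra_def by (rule hull_minimal) auto

text \<open>The set on which the two maps agree is a subalgebra containing the generators; off
  \<open>W\<close> both are undefined in the same way.\<close>

lemma automorphism_ext: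
  assumes W: "vertex_subalgebra V W" "generated_subalgebra V W S = W" "S \<subseteq> W"
    and g: "g \<in> voa_automorphisms V W w" and g': "g' \<in> voa_automorphisms V W w"
    and eq: "\<And>s. s \<in> S \<Longrightarrow> g s = g' s"
  shows "g = g'"
proof -
  let ?E = "{x\<in>W. g x = g' x}"
  have W': "0 \<in> W" "\<And>x y. x \<in> W \<Longrightarrow> y \<in> W \<Longrightarrow> x + y \<in> W" "\<And>c x. x \<in> W \<Longrightarrow> scal V c x \<in> W"
    using W(1) by (auto simp: vertex_subalgebra_def subspace_def)
  have zero: "h 0 = 0" if "h \<in> voa_automorphisms V W w" for h
  proof -
    have "h (scal V 0 0) = scal V 0 (h 0)" using that W'(1) unfolding voa_automorphisms_def by blast
    then show ?thesis by simp
  qed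
  have "vertex_subalgebra V ?E"
    unfolding vertex_subalgebra_def
    by (intro conjI subspaceI)
      (use g g' W(1) W' zero[OF g] zero[OF g'] in \<open>auto simp: voa_automorphisms_def vertex_subalgebra_def\<close>)
  then have "W \<subseteq> ?E"
    using generated_minimal[of ?E W S] W(2,3) eq by auto
  then have "g x = g' x" if "x \<in> W" for x using that by auto
  moreover have "g \<in> extensional W" "g' \<in> extensional W"
    using g g' by (auto simp: voa_automorphisms_def Bij_def)
  ultimately show ?thesis by (meson extensionalityI)
qed

end

context affine_sl2_vertex_algebra
begin

lemma automorphism_W3:
  assumes W: "vertex_subalgebra V W" "W \<subseteq> N" "W3 \<in> W" and g: "g \<in> voa_automorphisms V W \<omega>"
  shows "g W3 = W3 \<or> g W3 = - W3"
proof -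
  have om: "\<omega> \<in> W" by (rule omega_in_subalgebra[OF W])
  have g_np: "g (nprod V u n v) = nprod V (g u) n (g v)" if "u \<in> W" "v \<in> W" for u v n
    using g that by (auto simp: voa_automorphisms_def)
  have g_sc: "g (scal V c v) = scal V c (g v)" if "v \<in> W" for c v
    using g that by (auto simp: voa_automorphisms_def)
  have g_om: "g \<omega> = \<omega>" and g_W: "\<And>v. v \<in> W \<Longrightarrow> g v \<in> W"
    using g by (auto simp: voa_automorphisms_def Bij_def bij_betw_def)
  have "g 0 = 0" using g_sc[of W3 0] W(3) by simp
  have "nprod V \<omega> 1 (g W3) = scal V 3 (g W3)" "nprod V \<omega> 2 (g W3) = 0"
    using g_np[OF om W(3), of 1] g_np[OF om W(3), of 2] g_sc[OF W(3)] \<open>g 0 = 0\<close>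
    by (simp_all add: g_om omega_1_W3 omega_2_W3)
  then obtain c where c: "g W3 = scal V c W3"
    using primary_weight_3 g_W[OF W(3)] W(2) by blast
  \<comment> \<open>The coefficient of \<open>\<omega>\<close> in \<open>W3_3 W3\<close>; applying
    \<open>g\<close> multiplies it by \<open>c * c\<close> and fixes
    \<open>\<omega>\<close>.\<close>
  define b where "b = 18 * k ^ 2 * (k - 2) * (3 * k + 4) * (2 * k * (k + 2))"
  have b: "b \<noteq> 0" using W3_3_W3_coeff level by (auto simp: b_def add_eq_0_iff2)
  have w: "nprod V W3 3 W3 = scal V b \<omega>"
    unfolding W3_3_W3 Omega_eq b_def by simp
  have "scal V b \<omega> = g (nprod V W3 3 W3)" using w g_sc[OF om] g_om by simp
  also have "\<dots> = scal V (c * c * b) \<omega>"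
    unfolding g_np[OF W(3) W(3)] c by (simp add: w mult_ac)
  finally have "scal V (b * (1 - c * c)) \<omega> = 0" by (simp add: algebra_simps)
  then have "c * c = 1" using b Omega_nonzero by (auto simp: Omega_eq)
  then have "c = 1 \<or> c = - 1" by (simp add: square_eq_1_iff)
  then show ?thesis by (auto simp: c)
qed

text \<open>Otherwise \<open>W3\<close> and with it \<open>W3_3 W3\<close> would vanish. This makes
  the involution differ from the identity.\<close>

lemma W3_neq_minus_W3: "W3 \<noteq> - W3"
proof
  assume "W3 = - W3"
  then have "scal V 2 W3 = 0" by (metis add.right_inverse scale_left_distrib scale_one one_add_one)
  then have "W3 = 0" by simp
  then have "scal V (18 * k ^ 2 * (k - 2) * (3 * k + 4)) \<Omega> = 0" using W3_3_W3 by simp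
  then show False using Omega_nonzero W3_3_W3_coeff by simp
qed

section \<open>The involution and the automorphism group\<close>

context
  fixes \<sigma> :: "'v \<Rightarrow> 'v"
  assumes \<sigma>: "vertex_hom V V \<sigma>" "\<sigma> (a ch) = - a ch" "\<sigma> (a ce) = a cf" "\<sigma> (a cf) = a ce"
begin

private lemma \<sigma>_simps:
  "\<sigma> (u + v) = \<sigma> u + \<sigma> v" "\<sigma> (u - v) = \<sigma> u - \<sigma> v" "\<sigma> (- u) = - \<sigma> u" "\<sigma> (scal V c u) = scal V c (\<sigma> u)"
  "\<sigma> (nprod V u n v) = nprod V (\<sigma> u) n (\<sigma> v)" "\<sigma> vac = vac" "\<sigma> 0 = 0"
proof -
  interpret l: Vector_Spaces.linear "scal V" "scal V" \<sigma>
    using \<sigma>(1) by (simp add: vertex_hom_def)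
  show "\<sigma> (u + v) = \<sigma> u + \<sigma> v" "\<sigma> (u - v) = \<sigma> u - \<sigma> v" "\<sigma> (- u) = - \<sigma> u" "\<sigma> (scal V c u) = scal V c (\<sigma> u)"
    "\<sigma> 0 = 0"
    by (fact l.add l.diff l.neg l.scale l.zero)+
  show "\<sigma> (nprod V u n v) = nprod V (\<sigma> u) n (\<sigma> v)" "\<sigma> vac = vac"
    using \<sigma>(1) by (simp_all add: vertex_hom_def)
qed

lemma involution_omega: "\<sigma> \<omega> = \<omega>"
  by (rule eqI_functional)
    (simp add: parafermion_omega_def Let_def \<sigma>_simps \<sigma>(2-4) word_rules algebra_simps)

lemma involution_W3: "\<sigma> W3 = - W3"
  by (rule eqI_functional)
    (simp add: parafermion_W3_def Let_def \<sigma>_simps \<sigma>(2-4) word_rules algebra_simps power2_eq_square)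

lemma involution_involutive: "\<sigma> (\<sigma> v) = v"
proof (rule eqI_functional)
  fix \<phi> assume \<phi>: "functional \<phi>"
  have "\<sigma> (\<sigma> (a x)) = a x" for x by (cases x) (simp_all add: \<sigma>_simps \<sigma>(2-4))
  then have w: "\<sigma> (\<sigma> (act w vac)) = act w vac" for w
    by (induction w) (simp_all add: \<sigma>_simps)
  have "functional (\<lambda>v. \<phi> (\<sigma> (\<sigma> v) - v))"
    by unfold_locales (simp_all add: \<sigma>_simps \<phi> algebra_simps)
  then have "\<phi> (\<sigma> (\<sigma> v) - v) = 0"
    by (rule functional_zero_on_words) (simp add: w \<phi>)
  then show "\<phi> (\<sigma> (\<sigma> v)) = \<phi> v" using \<phi> by simp
qed

text \<open>The elements of \<open>W\<close> that \<open>\<sigma>\<close> maps into \<open>W\<close>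
  form a subalgebra containing the generator \<open>W3\<close>, hence are all of \<open>W\<close>;
  bijectivity follows since \<open>\<sigma>\<close> is its own inverse.\<close>

lemma involution_automorphism:
  assumes W: "vertex_subalgebra V W" "W \<subseteq> N" "generated_subalgebra V W {W3} = W" "W3 \<in> W"
  shows "restrict \<sigma> W \<in> voa_automorphisms V W \<omega>"
proof -
  have W': "0 \<in> W" "\<And>x y. x \<in> W \<Longrightarrow> y \<in> W \<Longrightarrow> x + y \<in> W" "\<And>c x. x \<in> W \<Longrightarrow> scal V c x \<in> W"
    "vac \<in> W" "\<And>u n v. u \<in> W \<Longrightarrow> v \<in> W \<Longrightarrow> nprod V u n v \<in> W"
    using W(1) by (auto simp: vertex_subalgebra_def subspace_def)
  have "vertex_subalgebra V {x\<in>W. \<sigma> x \<in> W}"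
    unfolding vertex_subalgebra_def by (intro conjI subspaceI) (auto simp: \<sigma>_simps W')
  moreover have "\<sigma> W3 \<in> W" using W'(3)[OF W(4), of "-1"] by (simp add: involution_W3)
  ultimately have "W \<subseteq> {x\<in>W. \<sigma> x \<in> W}"
    using generated_minimal[of "{x\<in>W. \<sigma> x \<in> W}" W "{W3}"] W(3,4) by auto
  then have s: "\<sigma> x \<in> W" if "x \<in> W" for x using that by auto
  have "bij_betw \<sigma> W W"
    by (rule bij_betw_byWitness[where f' = \<sigma>]) (auto simp: involution_involutive s)
  then have "restrict \<sigma> W \<in> Bij W"
    by (auto simp: Bij_def bij_betw_restrict_eq)
  moreover have "restrict \<sigma> W \<omega> = \<omega>"
    using omega_in_subalgebra[OF W(1,2,4)] by (simp add: involution_omega)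
  ultimately show ?thesis
    by (simp add: voa_automorphisms_def \<sigma>_simps W')
qed

lemma automorphism_group:
  assumes W: "vertex_subalgebra V W" "W \<subseteq> N" "generated_subalgebra V W {W3} = W" "W3 \<in> W"
  defines "\<theta> \<equiv> restrict \<sigma> W"
  shows "carrier (voa_Aut V W \<omega>) = generate (voa_Aut V W \<omega>) {\<theta>} \<and> order (voa_Aut V W \<omega>) = 2"
proof -
  interpret B: group "BijGroup W" by (rule group_BijGroup)
  let ?one = "\<lambda>x\<in>W. x"
  have \<theta>: "\<theta> \<in> voa_automorphisms V W \<omega>"
    unfolding \<theta>_def by (rule involution_automorphism[OF W])
  have om: "\<omega> \<in> W" by (rule omega_in_subalgebra[OF W(1,2,4)])
  have W': "\<And>x y. x \<in> W \<Longrightarrow> y \<in> W \<Longrightarrow> x + y \<in> W" "\<And>c x. x \<in> W \<Longrightarrow> scal V c x \<in> W"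
    "vac \<in> W" "\<And>u n v. u \<in> W \<Longrightarrow> v \<in> W \<Longrightarrow> nprod V u n v \<in> W"
    using W(1) by (auto simp: vertex_subalgebra_def subspace_def)
  have one: "?one \<in> voa_automorphisms V W \<omega>"
    using om id_Bij[of W] by (auto simp: voa_automorphisms_def W')
  have "g = ?one \<or> g = \<theta>" if g: "g \<in> voa_automorphisms V W \<omega>" for g
    using automorphism_W3[OF W(1,2,4) g]
  proof
    assume "g W3 = W3"
    then show ?thesis
      using automorphism_ext[OF W(1,3) _ g one] W(4) by auto
  next
    assume "g W3 = - W3"
    then show ?thesis
      using automorphism_ext[OF W(1,3) _ g \<theta>] W(4) by (auto simp: \<theta>_def involution_W3)
  qed
  then have A: "voa_automorphisms V W \<omega> = {?one, \<theta>}" using one \<theta> by auto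
  have ne: "?one \<noteq> \<theta>"
  proof
    assume "?one = \<theta>"
    then have "?one W3 = \<theta> W3" by simp
    then show False using W(4) W3_neq_minus_W3 by (simp add: \<theta>_def involution_W3)
  qed
  have Bij: "?one \<in> Bij W" "\<theta> \<in> Bij W" using one \<theta> by (auto simp: voa_automorphisms_def)
  have \<theta>W: "\<theta> x \<in> W" if "x \<in> W" for x
    using Bij(2) that by (auto simp: Bij_def bij_betw_def)
  have "compose W \<theta> \<theta> = ?one"
    using \<theta>W by (auto simp: compose_def \<theta>_def involution_involutive fun_eq_iff)
  then have sq: "\<theta> \<otimes>\<^bsub>BijGroup W\<^esub> \<theta> = \<one>\<^bsub>BijGroup W\<^esub>"
    using Bij by (simp add: BijGroup_def)
  have one_eq: "\<one>\<^bsub>BijGroup W\<^esub> = ?one" by (simp add: BijGroup_def)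
  have car: "\<theta> \<in> carrier (BijGroup W)" using Bij by (simp add: BijGroup_def)
  \<comment> \<open>The group structure on the automorphisms is inherited from the bijections of
    \<open>W\<close>, where the identity and the involution form a subgroup.\<close>
  have "subgroup {\<one>\<^bsub>BijGroup W\<^esub>, \<theta>} (BijGroup W)"
    by (rule B.subgroupI) (use car sq B.inv_equality[OF sq car car] in auto)
  then have "group (BijGroup W\<lparr>carrier := {\<one>\<^bsub>BijGroup W\<^esub>, \<theta>}\<rparr>)"
    by (rule B.subgroup_imp_group)
  moreover have eq: "voa_Aut V W \<omega> = BijGroup W\<lparr>carrier := {\<one>\<^bsub>BijGroup W\<^esub>, \<theta>}\<rparr>"
    by (simp add: voa_Aut_def A one_eq)
  ultimately interpret G: group "voa_Aut V W \<omega>" by simp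
  have c: "carrier (voa_Aut V W \<omega>) = {\<one>\<^bsub>voa_Aut V W \<omega>\<^esub>, \<theta>}" by (simp add: eq)
  have "carrier (voa_Aut V W \<omega>) \<subseteq> generate (voa_Aut V W \<omega>) {\<theta>}"
    unfolding c by (auto intro: generate.one generate.incl)
  moreover have "generate (voa_Aut V W \<omega>) {\<theta>} \<subseteq> carrier (voa_Aut V W \<omega>)"
    by (rule G.generate_incl) (simp add: c)
  moreover have "order (voa_Aut V W \<omega>) = 2"
    using ne by (simp add: order_def eq one_eq)
  ultimately show ?thesis by blast
qed

end

end

section \<open>Passage to the simple quotient\<close>

lemma vertex_hom_simps:
  assumes "vertex_hom V L \<pi>"
  shows "\<pi> (u + v) = \<pi> u + \<pi> v" "\<pi> (u - v) = \<pi> u - \<pi> v" "\<pi> (- u) = - \<pi> u"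
    "\<pi> (scal V c u) = scal L c (\<pi> u)" "\<pi> (nprod V u n v) = nprod L (\<pi> u) n (\<pi> v)"
    "\<pi> (vacuum V) = vacuum L" "\<pi> 0 = 0" "\<pi> (sum g A) = (\<Sum>i\<in>A. \<pi> (g i))"
proof -
  interpret l: Vector_Spaces.linear "scal V" "scal L" \<pi>
    using assms by (simp add: vertex_hom_def)
  show "\<pi> (u + v) = \<pi> u + \<pi> v" "\<pi> (u - v) = \<pi> u - \<pi> v" "\<pi> (- u) = - \<pi> u"
    "\<pi> (scal V c u) = scal L c (\<pi> u)" "\<pi> 0 = 0" "\<pi> (sum g A) = (\<Sum>i\<in>A. \<pi> (g i))"
    by (fact l.add l.diff l.neg l.scale l.zero l.sum)+
  show "\<pi> (nprod V u n v) = nprod L (\<pi> u) n (\<pi> v)" "\<pi> (vacuum V) = vacuum L"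
    using assms by (simp_all add: vertex_hom_def)
qed

lemma vertex_hom_parafermion:
  assumes "vertex_hom V L \<pi>"
  shows "\<pi> (parafermion_omega V k a) = parafermion_omega L k (\<pi> \<circ> a)"
    and "\<pi> (parafermion_W3 V k a) = parafermion_W3 L k (\<pi> \<circ> a)"
  by (simp_all add: parafermion_omega_def parafermion_W3_def Let_def vertex_hom_simps[OF assms])

lemma vertex_hom_primary:
  assumes "vertex_hom V L \<pi>" "parafermion_primary V k a i w"
  shows "\<pi> w \<in> heisenberg_commutant L (\<pi> \<circ> a)"
    and "nprod L (parafermion_omega L k (\<pi> \<circ> a)) 1 (\<pi> w) = scal L (of_nat i) (\<pi> w)"
proof -
  note \<pi> = vertex_hom_simps[OF assms(1)]
  have w: "w \<in> heisenberg_commutant V a" "nprod V (parafermion_omega V k a) 1 w = scal V (of_nat i) w"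
    using assms(2) by (auto simp: parafermion_primary_def Let_def)
  show "\<pi> w \<in> heisenberg_commutant L (\<pi> \<circ> a)"
    using w(1) by (auto simp: heisenberg_commutant_def simp flip: \<pi>(5) intro: \<pi>(7))
  show "nprod L (parafermion_omega L k (\<pi> \<circ> a)) 1 (\<pi> w) = scal L (of_nat i) (\<pi> w)"
    using arg_cong[OF w(2), of \<pi>] by (simp add: \<pi> vertex_hom_parafermion[OF assms(1)])
qed

text \<open>Relations and spanning words pass through the surjection \<open>\<pi>\<close>, and the
  vacuum stays nonzero because the maximal ideal is proper.\<close>

lemma affine_sl2_simple_quotient:
  fixes k :: int
  assumes "k \<ge> 3" "universal_affine_sl2 V (of_int k) a" "simple_quotient V L \<pi>"
  shows "affine_sl2_vertex_algebra L (of_int k) (\<pi> \<circ> a)"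
proof -
  interpret V: universal_affine_sl2 V "of_int k" a by (rule assms(2))
  have hom: "vertex_hom V L \<pi>" and sur: "surj \<pi>" and max: "maximal_vertex_ideal V {v. \<pi> v = 0}"
    and L: "vertex_algebra L"
    using assms(3) by (auto simp: simple_quotient_def)
  interpret L: vertex_algebra L by (rule L)
  note \<pi> = vertex_hom_simps[OF hom]
  show ?thesis
  proof (unfold_locales)
    fix x m y n v
    obtain u where v: "v = \<pi> u" using sur by (metis surjD)
    show "nprod L ((\<pi> \<circ> a) x) m (nprod L ((\<pi> \<circ> a) y) n v) - nprod L ((\<pi> \<circ> a) y) n (nprod L ((\<pi> \<circ> a) x) m v) =
         (\<Sum>z\<in>{ch, ce, cf}. scal L (sl2_bracket x y z) (nprod L ((\<pi> \<circ> a) z) (m + n) v))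
         + scal L (if m + n = 0 then of_int m * sl2_form x y * of_int k else 0) v"
      using arg_cong[OF V.affine_commutator[of x m y n u], of \<pi>]
      unfolding \<pi> v comp_def .
  next
    have w: "word_vector L (\<pi> \<circ> a) w = \<pi> (word_vector V a w)" for w
      by (induction w) (simp_all add: \<pi>)
    show "L.span (range (word_vector L (\<pi> \<circ> a))) = UNIV"
    proof (rule UNIV_eq_I[symmetric])
      fix v
      obtain u where v: "v = \<pi> u" using sur by (metis surjD)
      obtain p where "u = word_eval V a p" using V.word_eval_surj by (metis surjD)
      then have "v = (\<Sum>w\<in>Poly_Mapping.keys p. scal L (Poly_Mapping.lookup p w) (word_vector L (\<pi> \<circ> a) w))"
        by (simp add: v word_eval_def \<pi> w)
      then show "v \<in> L.span (range (word_vector L (\<pi> \<circ> a)))"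
        by (auto intro!: L.span_sum L.span_scale intro: L.span_base)
    qed
    show "vacuum L \<noteq> 0"
    proof
      assume "vacuum L = 0"
      then have "\<pi> (nprod V v (-1) (vacuum V)) = 0" for v by (simp add: \<pi>)
      then have "{v. \<pi> v = 0} = UNIV" by (auto simp: V.creation)
      then show False using max by (simp add: maximal_vertex_ideal_def)
    qed
    have "of_int m \<noteq> (0::complex)" if "m \<noteq> 0" for m using that by simp
    from this[of "k - 1"] this[of "k - 2"] this[of "k + 2"] this[of "3 * k + 4"] this[of "2 * k + 3"] this[of k]
    show "(of_int k :: complex) \<noteq> 0" "(of_int k :: complex) \<noteq> 1" "(of_int k :: complex) \<noteq> 2"
      "(of_int k :: complex) \<noteq> -2" "3 * of_int k + 4 \<noteq> (0 :: complex)" "2 * of_int k + 3 \<noteq> (0 :: complex)"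
      using assms(1) by (auto simp: eq_neg_iff_add_eq_0)
  qed
qed

theorem theorem3p4:
  fixes k :: int
    and V :: "'v::ab_group_add vertex_structure"
    and L :: "'l::ab_group_add vertex_structure"
    and a :: "sl2_basis \<Rightarrow> 'v"
    and \<pi> :: "'v \<Rightarrow> 'l"
    and W4 W5 :: 'v
    and \<theta>V :: "'v \<Rightarrow> 'v"
    and \<theta>L :: "'l \<Rightarrow> 'l"
  assumes "k \<ge> 3"
    and "universal_affine_sl2 V (of_int k) a"
    and "simple_quotient V L \<pi>"
    and "parafermion_primary V (of_int k) a 4 W4"
    and "parafermion_primary V (of_int k) a 5 W5"
    and "lifted_involution V a \<theta>V"
    and "\<forall>v. \<theta>L (\<pi> v) = \<pi> (\<theta>V v)"
  defines "\<omega> \<equiv> \<pi> (parafermion_omega V (of_int k) a)"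
    and "W3 \<equiv> \<pi> (parafermion_W3 V (of_int k) a)"
    and "K0 \<equiv> heisenberg_commutant L (\<pi> \<circ> a)"
  defines "W \<equiv> generated_subalgebra L K0 {\<omega>, W3, \<pi> W4, \<pi> W5}"
  defines "\<theta> \<equiv> restrict \<theta>L W"
  shows "generated_subalgebra L W {W3} = W \<and>
    carrier (voa_Aut L W \<omega>) = generate (voa_Aut L W \<omega>) {\<theta>} \<and>
    order (voa_Aut L W \<omega>) = 2"
proof -
  interpret V: universal_affine_sl2 V "of_int k" a by (rule assms(2))
  interpret L: affine_sl2_vertex_algebra L "of_int k" "\<pi> \<circ> a"
    by (rule affine_sl2_simple_quotient[OF assms(1-3)])
  have hom: "vertex_hom V L \<pi>" and sur: "surj \<pi>"
    using assms(3) by (auto simp: simple_quotient_def)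
  note \<pi> = vertex_hom_simps[OF hom]
  have \<omega>: "\<omega> = parafermion_omega L (of_int k) (\<pi> \<circ> a)" and W3: "W3 = parafermion_W3 L (of_int k) (\<pi> \<circ> a)"
    unfolding \<omega>_def W3_def by (rule vertex_hom_parafermion[OF hom])+
  have K0: "vertex_subalgebra L K0" unfolding K0_def by (rule L.vertex_subalgebra_N)
  have gens: "{\<omega>, W3, \<pi> W4, \<pi> W5} \<subseteq> K0"
    using L.omega_in_N L.W3_in_N vertex_hom_primary(1)[OF hom assms(4)] vertex_hom_primary(1)[OF hom assms(5)]
    by (simp add: \<omega> W3 K0_def)
  have W: "vertex_subalgebra L W" "W \<subseteq> K0" "{\<omega>, W3, \<pi> W4, \<pi> W5} \<subseteq> W"
    unfolding W_def
    by (rule L.vertex_subalgebra_generated[OF K0 gens] L.generated_subset[OF K0 gens]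
        L.generators_subset[OF K0 gens])+
  \<comment> \<open>It suffices that \<open>U\<close> contains the four generators of
    \<open>W\<close>; then \<open>W\<close> is contained in \<open>U\<close>.\<close>
  define U where "U = generated_subalgebra L W {W3}"
  have "{W3} \<subseteq> W" using W(3) by simp
  then have U: "vertex_subalgebra L U" "U \<subseteq> W" "W3 \<in> U"
    using L.vertex_subalgebra_generated[OF W(1), of "{W3}"] L.generated_subset[OF W(1), of "{W3}"]
      L.generators_subset[OF W(1), of "{W3}"]
    unfolding U_def by auto
  then have UN: "U \<subseteq> heisenberg_commutant L (\<pi> \<circ> a)" using W(2) by (simp add: K0_def)
  note U' = U(1) UN U(3)[unfolded W3]
  have "\<omega> \<in> U" unfolding \<omega> by (rule L.omega_in_subalgebra[OF U'])
  moreover have "\<pi> W4 \<in> U" "\<pi> W5 \<in> U"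
    using L.low_weight_in_subalgebra[OF U', of "\<pi> W4" 4] vertex_hom_primary[OF hom assms(4)]
      L.low_weight_in_subalgebra[OF U', of "\<pi> W5" 5] vertex_hom_primary[OF hom assms(5)]
    by simp_all
  ultimately have "W \<subseteq> U"
    unfolding W_def using U UN by (intro L.generated_minimal) (auto simp: K0_def)
  then have gen: "generated_subalgebra L W {W3} = W" using U(2) by (simp add: U_def)
  have \<theta>V: "vertex_hom V V \<theta>V" "\<theta>V (a ch) = - a ch" "\<theta>V (a ce) = a cf" "\<theta>V (a cf) = a ce"
    using assms(6) by (auto simp: lifted_involution_def)
  have \<theta>L: "\<theta>L (\<pi> v) = \<pi> (\<theta>V v)" for v using assms(7) by simp
  have "\<theta>L (u + v) = \<theta>L u + \<theta>L v \<and> \<theta>L (scal L c u) = scal L c (\<theta>L u)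
      \<and> \<theta>L (nprod L u n v) = nprod L (\<theta>L u) n (\<theta>L v)" for u v c n
  proof -
    \<comment> \<open>The map \<open>\<theta>L\<close> is given on images under
      \<open>\<pi>\<close>, so its properties are read off representatives.\<close>
    obtain u' v' where "u = \<pi> u'" "v = \<pi> v'" using sur by (metis surjD)
    then show ?thesis
      by (simp add: \<theta>L vertex_hom_simps[OF \<theta>V(1)] \<pi> flip: \<pi>(1,4,5))
  qed
  moreover have "\<theta>L (vacuum L) = vacuum L"
    using \<theta>L[of "vacuum V"] by (simp add: \<pi> vertex_hom_simps[OF \<theta>V(1)])
  ultimately have "vertex_hom L L \<theta>L"
    unfolding vertex_hom_def by (intro conjI) (unfold_locales, auto)
  then show ?thesis
    using L.automorphism_group[of \<theta>L W] W gen
    by (simp add: \<theta>_def \<theta>L \<theta>V \<pi> \<omega> W3 K0_def)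
qed

end
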